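(* Let $F$ be a PCA with alphabet $\{0,1\}$, neighborhood $\{0,1\}$ and parameters $\theta_{00},\theta_{01},\theta_{10},\theta_{11}\in[0,1]$, and let $p\in(0,1)$ be such that $$(1-p)\theta_{00}+p\,\theta_{01}=(1-p)\theta_{10}+p\,\theta_{11}=p$$ (so that $\mu_p$ is invariant for $F$). Let $(X^n_k)_{k,n\in\mathbb Z}$ be the stationary space-time diagram of $F$ associated with $\mu_p$. Then: \begin{enumerate} \item Each line of angle $\pi/3$ of the space-time diagram is distributed according to $\mu_p$: for every $i\in\mathbb Z$, the variables $(X_i^k)_{k\in\mathbb Z}$ are i.i.d. Bernoulli of parameter $p$. \item The correlations of these lines are those of a transversal PCA of direction $\vec v$ with parameters $\vartheta_{00}=\theta_{00}$, $\vartheta_{01}=\theta_{10}$, $\vartheta_{10}=\theta_{01}$, $\vartheta_{11}=\theta_{11}$. That is, the random field $(Z^m_j)_{j,m\in\mathbb Z}$ defined by $Z^m_j=X_m^{-m-j}$ has the law of the stationary space-time diagram, associated with $\mu_p$, of the PCA with neighborhood $\{0,1\}$ and parameters $\vartheta_{xy}$; in particular, given the line $(X_i^k)_{k\in\mathbb Z}$, the variables $(X_{i+1}^k)_{k\in\mathbb Z}$ are independent and $X_{i+1}^k$ equals $1$ with probability $\vartheta_{xy}$ where $x=X_i^{k+1}$ and $y=X_i^k$. \end{enumerate}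
   Context: A PCA with alphabet $\{0,1\}$ and neighborhood $\{0,1\}$ is determined by four parameters $\theta_{xy}\in[0,1]$: the new value of cell $k\in\mathbb Z$ equals $1$ with probability $\theta_{xy}$ when the current values of cells $k$ and $k+1$ are $x$ and $y$, independently for different cells. $\mu_p$ denotes the Bernoulli product measure on $\{0,1\}^{\mathbb Z}$ in which each coordinate equals $1$ with probability $p$; it is invariant if applying one step of the PCA to a configuration of law $\mu_p$ gives a configuration of law $\mu_p$. When $\mu_p$ is invariant, the stationary space-time diagram associated with $\mu_p$ is the random field $(X^n_k)_{k,n\in\mathbb Z}$ ($k$ is the space coordinate, $n$ the time coordinate) such that, for every $n\in\mathbb Z$, $X^n=(X^n_k)_{k\in\mathbb Z}\sim\mu_p$ and, given $(X^m)_{m\le n}$, the variables $(X^{n+1}_k)_{k\in\mathbb Z}$ are independent with $\mathbb P(X^{n+1}_k=1\mid (X^m)_{m\le n})=\theta_{X^n_kX^n_{k+1}}$. The diagram is drawn on the triangular lattice, $X^n_k$ being placed at the point $(k+n/2,\sqrt3\,n/2)$; lines of angle $\pi/3$ are thus the sets where $k$ is constant. A transversal PCA of direction $\vec v$ exists when the diagram, rotated by $2\pi/3$, has the law of a space-time diagram generated by a PCA of neighborhood $\{0,1\}$; in it, $X_{i+1}^k$ is updated from the left neighbor $X_i^{k+1}$ and the right neighbor $X_i^k$. *)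

theory Defs
  imports "HOL-Probability.Probability"
begin

text \<open>The alphabet \<open>{0,1}\<close> is \<^typ>\<open>bool\<close>, with \<open>True\<close> for 1. A configuration is a function
  \<open>int \<Rightarrow> bool\<close>, a PCA of neighborhood \<open>{0,1}\<close> is given by its parameters
  \<open>\<theta> :: bool \<Rightarrow> bool \<Rightarrow> real\<close>, and a random field \<open>X\<close> is written time first:
  \<open>X n k\<close> is the state of cell \<open>k\<close> at time \<open>n\<close>.\<close>

definition bernoulli_product :: "real \<Rightarrow> (int \<Rightarrow> bool) measure" where
  "bernoulli_product p = Pi\<^sub>M UNIV (\<lambda>_. measure_pmf (bernoulli_pmf p))"

definition pca_step :: "(bool \<Rightarrow> bool \<Rightarrow> real) \<Rightarrow> (int \<Rightarrow> bool) \<Rightarrow> (int \<Rightarrow> bool) measure" where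
  "pca_step \<theta> x = Pi\<^sub>M UNIV (\<lambda>k. measure_pmf (bernoulli_pmf (\<theta> (x k) (x (k + 1)))))"

definition pca_invariant :: "(bool \<Rightarrow> bool \<Rightarrow> real) \<Rightarrow> (int \<Rightarrow> bool) measure \<Rightarrow> bool" where
  "pca_invariant \<theta> \<mu> \<longleftrightarrow> \<mu> \<bind> pca_step \<theta> = \<mu>"

definition generated_sigma :: "'w measure \<Rightarrow> ('i \<Rightarrow> 'w \<Rightarrow> bool) \<Rightarrow> 'i set \<Rightarrow> 'w measure" where
  "generated_sigma M Y I = sigma (space M) {Y i -` A \<inter> space M | i A. i \<in> I}"

definition prob_given :: "'w measure \<Rightarrow> 'w measure \<Rightarrow> ('w \<Rightarrow> bool) \<Rightarrow> 'w \<Rightarrow> real" where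
  "prob_given M G P = real_cond_exp M G (indicator {\<omega> \<in> space M. P \<omega>})"

definition cond_indep_given :: "'w measure \<Rightarrow> 'w measure \<Rightarrow> ('i \<Rightarrow> 'w \<Rightarrow> bool) \<Rightarrow> bool" where
  "cond_indep_given M G Y \<longleftrightarrow>
     (\<forall>J A. finite J \<longrightarrow>
       (AE \<omega> in M. prob_given M G (\<lambda>\<omega>'. \<forall>j\<in>J. Y j \<omega>' \<in> A j) \<omega>
                   = (\<Prod>j\<in>J. prob_given M G (\<lambda>\<omega>'. Y j \<omega>' \<in> A j) \<omega>)))"

text \<open>The defining properties determine the joint law of the field, and only constrain that law;
  ``the'' stationary diagram is therefore any field, on any probability space, that has them.\<close>

definition stationary_diagram ::
    "'w measure \<Rightarrow> (bool \<Rightarrow> bool \<Rightarrow> real) \<Rightarrow> real \<Rightarrow> (int \<Rightarrow> int \<Rightarrow> 'w \<Rightarrow> bool) \<Rightarrow> bool" where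
  "stationary_diagram M \<theta> p X \<longleftrightarrow>
     prob_space M \<and>
     (\<forall>n k. X n k \<in> measurable M (count_space UNIV)) \<and>
     (\<forall>n. distr M (Pi\<^sub>M UNIV (\<lambda>_. count_space UNIV)) (\<lambda>\<omega> k. X n k \<omega>) = bernoulli_product p) \<and>
     (\<forall>n. let past = generated_sigma M (\<lambda>(m, k). X m k) ({..n} \<times> UNIV) in
            cond_indep_given M past (X (n + 1)) \<and>
            (\<forall>k. AE \<omega> in M. prob_given M past (X (n + 1) k) \<omega> = \<theta> (X n k \<omega>) (X n (k + 1) \<omega>)))"

definition field_law :: "'w measure \<Rightarrow> (int \<Rightarrow> int \<Rightarrow> 'w \<Rightarrow> bool) \<Rightarrow> (int \<times> int \<Rightarrow> bool) measure" where
  "field_law M X = distr M (Pi\<^sub>M UNIV (\<lambda>_. count_space UNIV)) (\<lambda>\<omega> (n, k). X n k \<omega>)"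

end

theory Submission
  imports Defs
begin

text \<open>
  Everything reduces to finite triangles of cells, on which the law of the diagram is an explicit
  product that is symmetric under the rotation.

  Take the triangle of all cells \<open>(n, k)\<close> with \<open>a \<le> n\<close>, \<open>c \<le> k\<close> and \<open>n + k \<le> s\<close>. Both parents
  \<open>(n - 1, k)\<close> and \<open>(n - 1, k + 1)\<close> of a cell above the bottom row are again in it. The probability
  that a stationary diagram shows a given pattern \<open>x\<close> on it is therefore the product of \<open>b (x t)\<close>
  over the cells \<open>t\<close> of the bottom row and of the transition probabilities
  \<open>\<theta>(left parent, right parent; cell)\<close> over all other cells, where \<open>b\<close> is the Bernoulli weight of
  parameter \<open>p\<close>. Divide this by the product of \<open>b (x t)\<close> over the whole triangle: what is left is
  one factor \<open>\<theta>(u, v; w) / b w\<close> for each small upward triangle with bottom corners \<open>u\<close>, \<open>v\<close> and top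
  corner \<open>w\<close>. The two balance equations for \<open>p\<close> say exactly that
  \<open>b v \<cdot> \<theta>(u, v; w) = b w \<cdot> \<theta>'(w, u; v)\<close> (\<open>rotated_parameter_pmf_swap\<close>), so this factor also
  equals \<open>\<theta>'(w, u; v) / b v\<close>. The same small triangles then describe a diagram with parameters
  \<open>\<theta>'\<close> that starts from the left side \<open>k = c\<close> of the triangle and evolves in the direction of
  increasing \<open>k\<close>. Hence the rotated field has the triangle laws of a diagram for \<open>\<theta>'\<close>
  (\<open>triangle_law_rotate\<close>).

  It remains to see that triangle laws and stationary diagrams are the same thing. From a
  stationary diagram the law of a trapezoid, that is of a triangle cut off at some height, follows
  by adding one row after the other (\<open>triangle_law_of_stationary_diagram\<close>). Conversely, summing
  over the states of the top row removes it, so triangle laws give trapezoid laws, and these give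
  the Bernoulli law of each row (\<open>distr_row_of_triangle_law\<close>) and the conditional law of a row
  given any \<open>\<sigma>\<close>-algebra between the preceding row and the whole past (\<open>cond_exp_next_row\<close>).
  The freedom in the \<open>\<sigma>\<close>-algebra yields both the conditioning on the past, which is part of being
  a stationary diagram, and the conditioning on a single line. As triangles exhaust the plane, their
  laws determine the law of the field (\<open>field_law_unique\<close>). Invariance of the Bernoulli measure is
  read off from two consecutive rows of the given diagram.
\<close>

section \<open>Cylinder events of a family of boolean random variables\<close>

text \<open>The sets \<open>A j\<close> may be any sets of states: singletons give the atoms on which finite laws are
  computed, and \<open>UNIV\<close> leaves a coordinate free, so that cylinders over different index sets can be
  compared.\<close>

definition cylinder :: "'w measure \<Rightarrow> ('i \<Rightarrow> 'w \<Rightarrow> bool) \<Rightarrow> 'i set \<Rightarrow> ('i \<Rightarrow> bool set) \<Rightarrow> 'w set" where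
  "cylinder M Y J A = {\<omega> \<in> space M. \<forall>j\<in>J. Y j \<omega> \<in> A j}"

locale bool_field = prob_space M for M :: "'w measure" +
  fixes Y :: "'i \<Rightarrow> 'w \<Rightarrow> bool"
  assumes measurable_Y [measurable]: "\<And>i. Y i \<in> measurable M (count_space UNIV)"
begin

lemma cylinder_sets [measurable]: "finite J \<Longrightarrow> cylinder M Y J A \<in> sets M"
  unfolding cylinder_def by measurable

lemma cylinder_subset_space: "cylinder M Y J A \<subseteq> space M"
  by (auto simp: cylinder_def)

lemma cylinder_Int:
  "cylinder M Y J A \<inter> cylinder M Y K B =
   cylinder M Y (J \<union> K) (\<lambda>i. (if i \<in> J then A i else UNIV) \<inter> (if i \<in> K then B i else UNIV))"
  by (auto simp: cylinder_def split: if_splits)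

lemma cylinder_extend:
  assumes "F \<subseteq> D"
  shows "cylinder M Y F A = cylinder M Y D (\<lambda>i. if i \<in> F then A i else UNIV)"
  using assms by (auto simp: cylinder_def)

text \<open>A cylinder is the disjoint union of its atoms; expanding a product of sums of indicators gives
  this without talking about disjointness.\<close>

lemma indicator_cylinder_eq_sum_atoms:
  assumes "finite J"
  shows "(indicator (cylinder M Y J A) \<omega> :: real) =
         (\<Sum>x\<in>PiE J A. indicator (cylinder M Y J (\<lambda>i. {x i})) \<omega>)"
proof (cases "\<omega> \<in> space M")
  case True
  have prod: "(indicator (cylinder M Y J B) \<omega> :: real) = (\<Prod>j\<in>J. of_bool (Y j \<omega> \<in> B j))" for B
    using assms True by (auto simp: cylinder_def indicator_def prod_zero_iff)
  have "(indicator (cylinder M Y J A) \<omega> :: real) = (\<Prod>j\<in>J. \<Sum>v\<in>A j. of_bool (Y j \<omega> \<in> {v}))"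
    unfolding prod by (intro prod.cong refl) (auto simp: of_bool_def if_distrib cong: if_cong)
  also have "\<dots> = (\<Sum>x\<in>PiE J A. \<Prod>j\<in>J. of_bool (Y j \<omega> \<in> {x j}))"
    by (rule prod_sum_PiE) (use assms in auto)
  finally show ?thesis by (simp only: prod)
qed (auto simp: cylinder_def)

text \<open>An identity between integrals over cylinders thus needs to be checked on atoms only.\<close>

lemma set_integral_cylinder_eq_sum_atoms:
  fixes h :: "'w \<Rightarrow> real"
  assumes "finite J" "integrable M h"
  shows "(\<integral>\<omega>\<in>cylinder M Y J A. h \<omega> \<partial>M) = (\<Sum>x\<in>PiE J A. \<integral>\<omega>\<in>cylinder M Y J (\<lambda>i. {x i}). h \<omega> \<partial>M)"
proof -
  have "(\<integral>\<omega>\<in>cylinder M Y J A. h \<omega> \<partial>M) =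
        (\<integral>\<omega>. (\<Sum>x\<in>PiE J A. indicator (cylinder M Y J (\<lambda>i. {x i})) \<omega> * h \<omega>) \<partial>M)"
    unfolding set_lebesgue_integral_def
    by (subst indicator_cylinder_eq_sum_atoms[OF assms(1)]) (simp add: sum_distrib_right)
  also have "\<dots> = (\<Sum>x\<in>PiE J A. \<integral>\<omega>\<in>cylinder M Y J (\<lambda>i. {x i}). h \<omega> \<partial>M)"
    unfolding set_lebesgue_integral_def using assms
    by (subst Bochner_Integration.integral_sum) (auto intro: integrable_real_mult_indicator simp: mult.commute)
  finally show ?thesis .
qed

lemma prob_cylinder_eq_sum_atoms:
  assumes "finite J"
  shows "prob (cylinder M Y J A) = (\<Sum>x\<in>PiE J A. prob (cylinder M Y J (\<lambda>i. {x i})))"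
proof -
  have "(\<integral>\<omega>\<in>cylinder M Y J B. 1 \<partial>M) = prob (cylinder M Y J B)" for B
    using assms by (simp add: set_integral_const emeasure_eq_measure)
  then show ?thesis
    using set_integral_cylinder_eq_sum_atoms[OF assms, of "\<lambda>_. 1" A] by simp
qed

lemma set_integral_indicator_cylinder:
  "(\<integral>\<omega>\<in>cylinder M Y J A. indicator E \<omega> \<partial>M) = prob (cylinder M Y J A \<inter> E)"
proof -
  have "(\<integral>\<omega>\<in>cylinder M Y J A. indicator E \<omega> \<partial>M) = (\<integral>\<omega>. indicator (cylinder M Y J A \<inter> E) \<omega> \<partial>M)"
    unfolding set_lebesgue_integral_def by (intro Bochner_Integration.integral_cong) (auto simp: indicator_def)
  also have "\<dots> = prob (cylinder M Y J A \<inter> E)"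
    using cylinder_subset_space[of J A] by (simp add: Int_absorb2 le_infI1)
  finally show ?thesis .
qed

lemma cylinder_in_cylinders:
  "finite F \<Longrightarrow> F \<subseteq> I \<Longrightarrow> cylinder M Y F A \<in> {cylinder M Y F A | F A. finite F \<and> F \<subseteq> I}"
  by (rule CollectI, rule exI[of _ F], rule exI[of _ A]) simp

lemma generated_sets_eq_sigma_cylinders:
  "sets (generated_sigma M Y I) =
   sigma_sets (space M) {cylinder M Y F A | F A. finite F \<and> F \<subseteq> I}"
proof -
  let ?G = "{Y i -` A \<inter> space M | i A. i \<in> I}"
  let ?C = "{cylinder M Y F A | F A. finite F \<and> F \<subseteq> I}"
  have "sets (generated_sigma M Y I) = sigma_sets (space M) ?G"
    unfolding generated_sigma_def by (rule sets_measure_of) auto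
  also have "\<dots> = sigma_sets (space M) ?C"
  proof (rule sigma_sets_eqI)
    fix a assume "a \<in> ?G"
    then obtain i A where "i \<in> I" "a = Y i -` A \<inter> space M" by auto
    then have a: "a = cylinder M Y {i} (\<lambda>_. A)" by (auto simp: cylinder_def)
    show "a \<in> sigma_sets (space M) ?C"
      unfolding a using \<open>i \<in> I\<close> by (intro sigma_sets.Basic cylinder_in_cylinders) auto
  next
    fix b assume "b \<in> ?C"
    then obtain F A where F: "finite F" "F \<subseteq> I" and b: "b = cylinder M Y F A" by auto
    interpret S: sigma_algebra "space M" "sigma_sets (space M) ?G"
      by (rule sigma_algebra_sigma_sets) auto
    have "{\<omega> \<in> space M. \<forall>j\<in>F. Y j \<omega> \<in> A j} \<in> sigma_sets (space M) ?G"
    proof (rule S.sets_Collect_finite_All[OF _ F(1)])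
      fix j assume "j \<in> F"
      then have j: "j \<in> I" using F(2) by (rule rev_subsetD)
      have eq: "{\<omega> \<in> space M. Y j \<omega> \<in> A j} = Y j -` A j \<inter> space M" by blast
      have "Y j -` A j \<inter> space M \<in> ?G"
        by (rule CollectI, rule exI[of _ j], rule exI[of _ "A j"], rule conjI, rule refl, rule j)
      then show "{\<omega> \<in> space M. Y j \<omega> \<in> A j} \<in> sigma_sets (space M) ?G"
        unfolding eq by (rule sigma_sets.Basic)
    qed
    then show "b \<in> sigma_sets (space M) ?G" unfolding b cylinder_def .
  qed
  finally show ?thesis .
qed

lemma space_generated_sigma [simp]: "space (generated_sigma M Y I) = space M"
  unfolding generated_sigma_def by (rule space_measure_of) auto

lemma cylinder_in_generated_sigma:
  "finite F \<Longrightarrow> F \<subseteq> I \<Longrightarrow> cylinder M Y F A \<in> sets (generated_sigma M Y I)"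
  unfolding generated_sets_eq_sigma_cylinders by (intro sigma_sets.Basic cylinder_in_cylinders)

lemma measurable_generated_sigma:
  assumes "i \<in> I"
  shows "Y i \<in> measurable (generated_sigma M Y I) (count_space UNIV)"
proof (rule measurableI)
  fix A :: "bool set"
  have "Y i -` A \<inter> space (generated_sigma M Y I) = cylinder M Y {i} (\<lambda>_. A)"
    by (auto simp: cylinder_def)
  then show "Y i -` A \<inter> space (generated_sigma M Y I) \<in> sets (generated_sigma M Y I)"
    using cylinder_in_generated_sigma[of "{i}" I "\<lambda>_. A"] assms by simp
qed simp

lemma subalgebra_generated_sigma: "subalgebra M (generated_sigma M Y I)"
proof -
  have "sigma_sets (space M) {cylinder M Y F A | F A. finite F \<and> F \<subseteq> I} \<subseteq> sets M"
    by (rule sets.sigma_sets_subset) auto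
  then show ?thesis
    unfolding subalgebra_def generated_sets_eq_sigma_cylinders by simp
qed

lemma sigma_finite_subalgebraI: "subalgebra M G \<Longrightarrow> sigma_finite_subalgebra M G"
  unfolding sigma_finite_subalgebra_def
  using finite_measure.axioms(1)[OF finite_measure_restr_to_subalg[OF _ finite_measure_axioms]] by simp

text \<open>The cylinders over finite subsets of \<open>I\<close> are stable under intersection and generate the
  \<open>\<sigma>\<close>-algebra of the variables in \<open>I\<close>. The sets on which \<open>f\<close> and \<open>g\<close> have the same integral form a
  Dynkin system, so agreement on cylinders already identifies a conditional expectation.\<close>

lemma cond_exp_generated_eqI:
  fixes f g :: "'w \<Rightarrow> real"
  assumes int: "integrable M f" "integrable M g"
    and meas: "g \<in> borel_measurable (generated_sigma M Y I)"
    and eq: "\<And>F A. finite F \<Longrightarrow> F \<subseteq> I \<Longrightarrow>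
               (\<integral>\<omega>\<in>cylinder M Y F A. f \<omega> \<partial>M) = (\<integral>\<omega>\<in>cylinder M Y F A. g \<omega> \<partial>M)"
  shows "AE \<omega> in M. real_cond_exp M (generated_sigma M Y I) f \<omega> = g \<omega>"
proof -
  let ?G = "generated_sigma M Y I"
  let ?C = "{cylinder M Y F A | F A. finite F \<and> F \<subseteq> I}"
  let ?h = "\<lambda>\<omega>. f \<omega> - g \<omega>"
  interpret sigma_finite_subalgebra M ?G
    by (intro sigma_finite_subalgebraI subalgebra_generated_sigma)
  have h: "integrable M ?h" using int by auto
  have seth: "set_integrable M A ?h" if "A \<in> sets M" for A
    using integrable_mult_indicator[OF that h] by (simp add: set_integrable_def)
  have GM: "A \<in> sets M" if "A \<in> sigma_sets (space M) ?C" for A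
    using that subalgebra_generated_sigma[of I]
    by (auto simp: subalgebra_def generated_sets_eq_sigma_cylinders)
  have setf: "set_integrable M A f" "set_integrable M A g" if "A \<in> sets M" for A
    using integrable_mult_indicator[OF that int(1)] integrable_mult_indicator[OF that int(2)]
    by (auto simp: set_integrable_def)
  have diff: "(\<integral>\<omega>\<in>A. ?h \<omega> \<partial>M) = (\<integral>\<omega>\<in>A. f \<omega> \<partial>M) - (\<integral>\<omega>\<in>A. g \<omega> \<partial>M)" if "A \<in> sets M" for A
    using setf[OF that] by (simp add: set_integral_diff(2))
  have zero: "(\<integral>\<omega>\<in>A. ?h \<omega> \<partial>M) = 0" if "A \<in> sets ?G" for A
  proof -
    have "Int_stable ?C"
    proof (rule Int_stableI)
      fix a b assume "a \<in> ?C" "b \<in> ?C"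
      then obtain F A K B where *: "finite F" "F \<subseteq> I" "a = cylinder M Y F A"
          "finite K" "K \<subseteq> I" "b = cylinder M Y K B" by blast
      have "finite (F \<union> K)" "F \<union> K \<subseteq> I" using * by auto
      then show "a \<inter> b \<in> ?C"
        unfolding *(3,6) cylinder_Int by (rule cylinder_in_cylinders)
    qed
    moreover have "?C \<subseteq> Pow (space M)" using cylinder_subset_space by auto
    moreover have "A \<in> sigma_sets (space M) ?C" using that by (simp add: generated_sets_eq_sigma_cylinders)
    ultimately show ?thesis
    proof (induction rule: sigma_sets_induct_disjoint)
      case (basic A)
      then obtain F B where "finite F" "F \<subseteq> I" "A = cylinder M Y F B" by blast
      then show ?case using diff[of A] eq[of F B] by simp
    next
      case empty
      show ?case by (simp add: set_lebesgue_integral_def)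
    next
      case (compl A)
      have "(\<integral>\<omega>\<in>space M. ?h \<omega> \<partial>M) = (\<integral>\<omega>\<in>A. ?h \<omega> \<partial>M) + (\<integral>\<omega>\<in>space M - A. ?h \<omega> \<partial>M)"
      proof (subst set_integral_Un[symmetric])
        have "A \<subseteq> space M" using GM[OF compl(1)] sets.sets_into_space by blast
        then show "(\<integral>\<omega>\<in>space M. ?h \<omega> \<partial>M) = (\<integral>\<omega>\<in>A \<union> (space M - A). ?h \<omega> \<partial>M)"
          by (simp add: Un_absorb1)
      qed (use seth GM[OF compl(1)] in auto)
      moreover have "(\<integral>\<omega>\<in>space M. ?h \<omega> \<partial>M) = 0"
        \<comment> \<open>the whole space is the cylinder without constraints\<close>
        using diff[of "space M"] eq[of "{}" undefined] by (simp add: cylinder_def)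
      ultimately show ?case using compl by simp
    next
      case (union A)
      have "(\<integral>\<omega>\<in>(\<Union>i. A i). ?h \<omega> \<partial>M) = (\<Sum>i. (\<integral>\<omega>\<in>A i. ?h \<omega> \<partial>M))"
      proof (rule lebesgue_integral_countable_add)
        show "A i \<in> sets M" for i using union GM by blast
        show "A i \<inter> A j = {}" if "i \<noteq> j" for i j
          using union that by (auto simp: disjoint_family_on_def)
        show "set_integrable M (\<Union>i. A i) ?h" using union GM by (intro seth) blast
      qed
      then show ?case using union by simp
    qed
  qed
  show ?thesis
  proof (rule real_cond_exp_charact[OF _ int meas])
    fix A assume A: "A \<in> sets ?G"
    then have "A \<in> sets M" using subalgebra_generated_sigma[of I] by (auto simp: subalgebra_def)
    then show "(\<integral>\<omega>\<in>A. f \<omega> \<partial>M) = (\<integral>\<omega>\<in>A. g \<omega> \<partial>M)" using zero[OF A] diff by simp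
  qed
qed

lemma measurable_field: "(\<lambda>\<omega> i. Y i \<omega>) \<in> measurable M (Pi\<^sub>M UNIV (\<lambda>_. count_space UNIV))"
  by (rule measurable_PiM_single') auto

lemma emeasure_distr_cylinder:
  assumes "finite J"
  shows "emeasure (distr M (Pi\<^sub>M UNIV (\<lambda>_. count_space UNIV)) (\<lambda>\<omega> i. Y i \<omega>))
           (prod_emb UNIV (\<lambda>_. count_space UNIV) J (Pi\<^sub>E J A)) = prob (cylinder M Y J A)"
proof -
  have "(\<lambda>\<omega> i. Y i \<omega>) -` prod_emb UNIV (\<lambda>_. count_space UNIV) J (Pi\<^sub>E J A) \<inter> space M = cylinder M Y J A"
    by (auto simp: prod_emb_def cylinder_def)
  then show ?thesis
    using assms by (subst emeasure_distr[OF measurable_field]) (auto intro!: sets_PiM_I simp: emeasure_eq_measure)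
qed

lemma distr_field_eqI:
  assumes "bool_field N Z"
    and "\<And>J A. finite J \<Longrightarrow> prob (cylinder M Y J A) = measure N (cylinder N Z J A)"
  shows "distr M (Pi\<^sub>M UNIV (\<lambda>_. count_space UNIV)) (\<lambda>\<omega> i. Y i \<omega>) =
         distr N (Pi\<^sub>M UNIV (\<lambda>_. count_space UNIV)) (\<lambda>\<omega> i. Z i \<omega>)"
proof (rule measure_eqI_PiM_infinite[where I = UNIV and M = "\<lambda>_. count_space UNIV"])
  interpret N: bool_field N Z by fact
  show "finite_measure (distr M (Pi\<^sub>M UNIV (\<lambda>_. count_space UNIV)) (\<lambda>\<omega> i. Y i \<omega>))"
    by (rule finite_measure_distr[OF measurable_field])
  show "emeasure (distr M (Pi\<^sub>M UNIV (\<lambda>_. count_space UNIV)) (\<lambda>\<omega> i. Y i \<omega>)) (prod_emb UNIV (\<lambda>_. count_space UNIV) J (Pi\<^sub>E J A)) =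
    emeasure (distr N (Pi\<^sub>M UNIV (\<lambda>_. count_space UNIV)) (\<lambda>\<omega> i. Z i \<omega>)) (prod_emb UNIV (\<lambda>_. count_space UNIV) J (Pi\<^sub>E J A))"
    if "finite J" for J A
    using that by (simp add: emeasure_distr_cylinder N.emeasure_distr_cylinder assms(2))
qed auto

end

lemma sets_PiM_pmf: "sets (Pi\<^sub>M UNIV (\<lambda>i. measure_pmf (q i))) = sets (Pi\<^sub>M UNIV (\<lambda>_. count_space UNIV))"
  by (rule sets_PiM_cong) auto

lemma bool_field_PiM:
  "bool_field (Pi\<^sub>M UNIV (\<lambda>i. measure_pmf (q i))) (\<lambda>i x. x i)"
proof -
  interpret product_prob_space "\<lambda>i. measure_pmf (q i)" UNIV ..
  have "(\<lambda>x. x i) \<in> measurable (Pi\<^sub>M UNIV (\<lambda>i. measure_pmf (q i))) (measure_pmf (q i))" for i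
    by (rule measurable_component_singleton) simp
  then show ?thesis by unfold_locales (simp add: measurable_def)
qed

lemma measure_PiM_cylinder:
  assumes "finite J"
  shows "measure (Pi\<^sub>M UNIV (\<lambda>i. measure_pmf (q i))) (cylinder (Pi\<^sub>M UNIV (\<lambda>i. measure_pmf (q i))) (\<lambda>i x. x i) J A)
         = (\<Prod>j\<in>J. measure (measure_pmf (q j)) (A j))"
proof -
  interpret product_prob_space "\<lambda>i. measure_pmf (q i)" UNIV ..
  have "cylinder (Pi\<^sub>M UNIV (\<lambda>i. measure_pmf (q i))) (\<lambda>i x. x i) J A =
        prod_emb UNIV (\<lambda>i. measure_pmf (q i)) J (Pi\<^sub>E J A)"
    by (auto simp: cylinder_def prod_emb_def space_PiM)
  then show ?thesis using measure_PiM_emb[of J A] assms by simp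
qed

lemma (in bool_field) distr_eq_PiM_iff:
  "distr M (Pi\<^sub>M UNIV (\<lambda>_. count_space UNIV)) (\<lambda>\<omega> i. Y i \<omega>) = Pi\<^sub>M UNIV (\<lambda>i. measure_pmf (q i)) \<longleftrightarrow>
   (\<forall>J A. finite J \<longrightarrow> prob (cylinder M Y J A) = (\<Prod>j\<in>J. measure (measure_pmf (q j)) (A j)))"
    (is "?D = ?P \<longleftrightarrow> _")
proof
  interpret N: bool_field ?P "\<lambda>i x. x i" by (rule bool_field_PiM)
  have id: "distr ?P (Pi\<^sub>M UNIV (\<lambda>_. count_space UNIV)) (\<lambda>x i. x i) = ?P"
    by (rule distr_id2) (rule sets_PiM_pmf[symmetric])
  {
    assume eq: "?D = ?P"
    have "prob (cylinder M Y J A) = (\<Prod>j\<in>J. measure (measure_pmf (q j)) (A j))" if J: "finite J" for J A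
    proof -
      have "prob (cylinder M Y J A) = measure ?P (cylinder ?P (\<lambda>i x. x i) J A)"
        using emeasure_distr_cylinder[OF J, of A] N.emeasure_distr_cylinder[OF J, of A]
        by (simp add: eq id measure_nonneg)
      then show ?thesis by (simp add: measure_PiM_cylinder[OF J])
    qed
    then show "\<forall>J A. finite J \<longrightarrow> prob (cylinder M Y J A) = (\<Prod>j\<in>J. measure (measure_pmf (q j)) (A j))"
      by blast
  next
    assume "\<forall>J A. finite J \<longrightarrow> prob (cylinder M Y J A) = (\<Prod>j\<in>J. measure (measure_pmf (q j)) (A j))"
    then show "?D = ?P"
      using distr_field_eqI[OF N.bool_field_axioms] by (simp add: measure_PiM_cylinder id)
  }
qed

lemma emeasure_PiM_pmf_emb:
  assumes "finite J"
  shows "emeasure (Pi\<^sub>M UNIV (\<lambda>i. measure_pmf (q i))) (prod_emb UNIV (\<lambda>_. count_space UNIV) J (Pi\<^sub>E J A)) =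
         ennreal (\<Prod>j\<in>J. measure (measure_pmf (q j)) (A j))"
proof -
  interpret product_prob_space "\<lambda>i. measure_pmf (q i)" UNIV ..
  have "prod_emb UNIV (\<lambda>_. count_space UNIV) J (Pi\<^sub>E J A) = prod_emb UNIV (\<lambda>i. measure_pmf (q i)) J (Pi\<^sub>E J A)"
    by (simp add: prod_emb_def)
  then show ?thesis
    using measure_PiM_emb[of J A] assms by (simp add: emeasure_eq_measure)
qed

context bool_field
begin

lemma bool_field_reindex: "bool_field M (\<lambda>k. Y (f k))"
  by unfold_locales measurable

lemma cylinder_reindex:
  assumes "inj_on f J"
  shows "cylinder M (\<lambda>k. Y (f k)) J A = cylinder M Y (f ` J) (\<lambda>i. A (inv_into J f i))"
  using assms by (auto simp: cylinder_def)

text \<open>Used for the reflection \<open>k \<mapsto> - i - k\<close>, which turns a row of the rotated field into a line of the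
  diagram.\<close>

lemma distr_iid_reindex:
  assumes "distr M (Pi\<^sub>M UNIV (\<lambda>_. count_space UNIV)) (\<lambda>\<omega> i. Y i \<omega>) = Pi\<^sub>M UNIV (\<lambda>_. measure_pmf q)"
    and f: "inj f"
  shows "distr M (Pi\<^sub>M UNIV (\<lambda>_. count_space UNIV)) (\<lambda>\<omega> k. Y (f k) \<omega>) = Pi\<^sub>M UNIV (\<lambda>_. measure_pmf q)"
proof -
  interpret R: bool_field M "\<lambda>k. Y (f k)" by (rule bool_field_reindex)
  have "prob (cylinder M (\<lambda>k. Y (f k)) J A) = (\<Prod>j\<in>J. measure (measure_pmf q) (A j))" if J: "finite J" for J A
  proof -
    have inj: "inj_on f J" using f by (rule inj_on_subset) simp
    have "prob (cylinder M (\<lambda>k. Y (f k)) J A) = (\<Prod>i\<in>f ` J. measure (measure_pmf q) (A (inv_into J f i)))"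
      using assms(1) J unfolding cylinder_reindex[OF inj] distr_eq_PiM_iff by simp
    also have "\<dots> = (\<Prod>j\<in>J. measure (measure_pmf q) (A j))"
      by (subst prod.reindex[OF inj]) (auto intro!: prod.cong simp: inj)
    finally show ?thesis .
  qed
  then show ?thesis by (subst R.distr_eq_PiM_iff) auto
qed

lemma marginal_of_iid:
  assumes "distr M (Pi\<^sub>M UNIV (\<lambda>_. count_space UNIV)) (\<lambda>\<omega> i. Y i \<omega>) = Pi\<^sub>M UNIV (\<lambda>_. measure_pmf q)"
  shows "distr M (count_space UNIV) (Y i) = measure_pmf q"
proof (rule measure_eqI)
  fix A :: "bool set"
  have "Y i -` A \<inter> space M = cylinder M Y {i} (\<lambda>_. A)" by (auto simp: cylinder_def)
  moreover have "prob (cylinder M Y {i} (\<lambda>_. A)) = (\<Prod>j\<in>{i}. measure (measure_pmf q) A)"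
    using assms[unfolded distr_eq_PiM_iff, rule_format, of "{i}" "\<lambda>_. A"] by simp
  ultimately show "emeasure (distr M (count_space UNIV) (Y i)) A = emeasure (measure_pmf q) A"
    by (simp add: emeasure_distr emeasure_eq_measure measure_pmf.emeasure_eq_measure)
qed simp

lemma indep_vars_of_iid:
  assumes "distr M (Pi\<^sub>M UNIV (\<lambda>_. count_space UNIV)) (\<lambda>\<omega> i. Y i \<omega>) = Pi\<^sub>M UNIV (\<lambda>_. measure_pmf q)"
  shows "indep_vars (\<lambda>_. count_space UNIV) Y UNIV"
  by (subst indep_vars_iff_distr_eq_PiM)
     (simp_all add: marginal_of_iid[OF assms] assms restrict_UNIV)

end

text \<open>The transition probabilities are arbitrary functions of two states, hence measurable as finite
  case distinctions.\<close>

lemma borel_measurable_bool_pair: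
  fixes g :: "bool \<Rightarrow> bool \<Rightarrow> real"
  assumes [measurable]: "P \<in> measurable N (count_space UNIV)" "Q \<in> measurable N (count_space UNIV)"
  shows "(\<lambda>\<omega>. g (P \<omega>) (Q \<omega>)) \<in> borel_measurable N"
proof -
  have "(\<lambda>\<omega>. g (P \<omega>) (Q \<omega>)) = (\<lambda>\<omega>. if P \<omega> then if Q \<omega> then g True True else g True False
          else if Q \<omega> then g False True else g False False)"
    by auto
  then show ?thesis by simp
qed

text \<open>Singletons \<open>J\<close> identify each \<open>r j (A j)\<close> as the conditional probability of one coordinate.\<close>

lemma cond_indep_given_if_product:
  assumes "\<And>J A. finite J \<Longrightarrow>
    AE \<omega> in M. prob_given M G (\<lambda>\<omega>'. \<forall>j\<in>J. Y j \<omega>' \<in> A j) \<omega> = (\<Prod>j\<in>J. r j (A j) \<omega>)"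
  shows "cond_indep_given M G Y"
  unfolding cond_indep_given_def
proof (intro allI impI)
  fix J :: "'a set" and A assume J: "finite J"
  have "AE \<omega> in M. prob_given M G (\<lambda>\<omega>'. Y j \<omega>' \<in> A j) \<omega> = r j (A j) \<omega>" for j
    using assms[of "{j}" A] by simp
  then have "AE \<omega> in M. \<forall>j\<in>J. prob_given M G (\<lambda>\<omega>'. Y j \<omega>' \<in> A j) \<omega> = r j (A j) \<omega>"
    using J by (intro AE_finite_allI) auto
  with assms[OF J, of A]
  show "AE \<omega> in M. prob_given M G (\<lambda>\<omega>'. \<forall>j\<in>J. Y j \<omega>' \<in> A j) \<omega> =
      (\<Prod>j\<in>J. prob_given M G (\<lambda>\<omega>'. Y j \<omega>' \<in> A j) \<omega>)"
    by eventually_elim simp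
qed

section \<open>Laws of finite triangles and trapezoids\<close>

text \<open>The triangle \<open>a \<le> n\<close>, \<open>c \<le> k\<close>, \<open>n + k \<le> s\<close> cut off above row \<open>b\<close>. Row \<open>n\<close> of it is the interval
  \<open>{c..s - n}\<close>, which loses its right end with each step, so that the cells \<open>(n - 1, k)\<close> and
  \<open>(n - 1, k + 1)\<close> from which \<open>(n, k)\<close> is updated belong to the region whenever \<open>(n, k)\<close> does and
  \<open>n > a\<close>.\<close>

definition cells :: "int \<Rightarrow> int \<Rightarrow> int \<Rightarrow> int \<Rightarrow> (int \<times> int) set" where
  "cells a b c s = {(n, k). a \<le> n \<and> n \<le> b \<and> c \<le> k \<and> n + k \<le> s}"

text \<open>The law of the state of one cell when the row below it is as in \<open>x\<close>; cells of the bottom row \<open>a\<close>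
  are drawn from \<open>\<mu>\<^sub>p\<close>.\<close>

fun cell_kernel ::
  "(bool \<Rightarrow> bool \<Rightarrow> real) \<Rightarrow> real \<Rightarrow> int \<Rightarrow> (int \<times> int \<Rightarrow> bool) \<Rightarrow> int \<times> int \<Rightarrow> bool pmf" where
  "cell_kernel \<theta> p a x (n, k) =
     bernoulli_pmf (if n = a then p else \<theta> (x (n - 1, k)) (x (n - 1, k + 1)))"

definition trapezoid_law ::
  "'w measure \<Rightarrow> (bool \<Rightarrow> bool \<Rightarrow> real) \<Rightarrow> real \<Rightarrow> (int \<times> int \<Rightarrow> 'w \<Rightarrow> bool) \<Rightarrow>
   int \<Rightarrow> int \<Rightarrow> int \<Rightarrow> int \<Rightarrow> bool" where
  "trapezoid_law M \<theta> p Y a b c s \<longleftrightarrow>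
     (\<forall>x. measure M (cylinder M Y (cells a b c s) (\<lambda>t. {x t})) =
          (\<Prod>t\<in>cells a b c s. pmf (cell_kernel \<theta> p a x t) (x t)))"

text \<open>Row \<open>s - c\<close> contains only the apex \<open>(s - c, c)\<close>, so cutting there leaves the full triangle.\<close>

definition triangle_law ::
  "'w measure \<Rightarrow> (bool \<Rightarrow> bool \<Rightarrow> real) \<Rightarrow> real \<Rightarrow> (int \<times> int \<Rightarrow> 'w \<Rightarrow> bool) \<Rightarrow> bool" where
  "triangle_law M \<theta> p Y \<longleftrightarrow> (\<forall>a c s. trapezoid_law M \<theta> p Y a (s - c) c s)"

lemma finite_cells [simp]: "finite (cells a b c s)"
  by (rule finite_subset[of _ "{a..b} \<times> {c..s - a}"]) (auto simp: cells_def)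

lemma cells_next_row:
  assumes "a \<le> b + 1"
  shows "cells a (b + 1) c s = cells a b c s \<union> Pair (b + 1) ` {c..s - b - 1}"
    and "cells a b c s \<inter> Pair (b + 1) ` {c..s - b - 1} = {}"
  using assms by (force simp: cells_def image_iff)+

lemma cells_above_apex: "s - c \<le> b \<Longrightarrow> cells a b c s = cells a (s - c) c s"
  by (auto simp: cells_def)

lemma cells_single_row: "cells a a c s = Pair a ` {c..s - a}"
  by (force simp: cells_def image_iff)

text \<open>Trapezoids with top row \<open>n\<close> absorb every finite set of cells of the past, and can be chosen so wide
  that the row above them contains any given finite set of cells.\<close>

lemma finite_subset_cells:
  assumes "finite F" "F \<subseteq> {..n} \<times> UNIV" "finite J"
  obtains a c s where "a \<le> n" "F \<subseteq> cells a n c s" "J \<subseteq> {c..s - n - 1}"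
proof -
  have fin: "finite (fst ` F)" "finite (snd ` F \<union> J)" using assms by auto
  obtain a0 where a0: "\<And>n. n \<in> fst ` F \<Longrightarrow> a0 \<le> n"
    using fin(1) by (meson bdd_below_finite bdd_below_def)
  obtain c where c: "\<And>k. k \<in> snd ` F \<union> J \<Longrightarrow> c \<le> k"
    using fin(2) by (meson bdd_below_finite bdd_below_def)
  obtain d where d: "\<And>k. k \<in> snd ` F \<union> J \<Longrightarrow> k \<le> d"
    using fin(2) by (meson bdd_above_finite bdd_above_def)
  show ?thesis
  proof (rule that[of "min a0 n" c "d + n + 1"])
    show "F \<subseteq> cells (min a0 n) n c (d + n + 1)"
    proof
      fix t assume t: "t \<in> F"
      then have "a0 \<le> fst t" "c \<le> snd t" "snd t \<le> d" "fst t \<le> n"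
        using a0 c d assms(2) by auto
      then show "t \<in> cells (min a0 n) n c (d + n + 1)" by (auto simp: cells_def)
    qed
    show "J \<subseteq> {c..d + n + 1 - n - 1}" using c d by auto
  qed simp
qed

lemma cell_kernel_cong:
  assumes "t \<in> cells a (b + 1) c s" "\<And>u. u \<in> cells a b c s \<Longrightarrow> x u = y u"
  shows "cell_kernel \<theta> p a x t = cell_kernel \<theta> p a y t"
proof (cases t)
  case (Pair n k)
  have "x (n - 1, k) = y (n - 1, k) \<and> x (n - 1, k + 1) = y (n - 1, k + 1)" if "n \<noteq> a"
    using that assms(1) by (auto simp: Pair cells_def intro!: assms(2))
  then show ?thesis by (auto simp: Pair)
qed

lemma cylinder_row:
  "cylinder M Y (Pair n ` J) A = cylinder M (\<lambda>k. Y (n, k)) J (\<lambda>k. A (n, k))"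
  by (auto simp: cylinder_def)

lemma cylinder_next_row:
  assumes "a \<le> b + 1" "J \<subseteq> {c..s - b - 1}"
  shows "cylinder M Y (cells a (b + 1) c s)
           (\<lambda>t. if t \<in> cells a b c s then {x t} else if snd t \<in> J then A (snd t) else UNIV) =
         cylinder M Y (cells a b c s) (\<lambda>t. {x t}) \<inter> cylinder M (\<lambda>k. Y (b + 1, k)) J A"
    (is "cylinder M Y _ ?B = _")
proof -
  have new: "(b + 1, k) \<notin> cells a b c s" for k by (simp add: cells_def)
  have "cylinder M Y (cells a (b + 1) c s) ?B =
        cylinder M Y (cells a b c s) ?B \<inter> cylinder M Y (Pair (b + 1) ` {c..s - b - 1}) ?B"
    unfolding cells_next_row(1)[OF assms(1)] cylinder_def ball_Un by blast
  also have "cylinder M Y (cells a b c s) ?B = cylinder M Y (cells a b c s) (\<lambda>t. {x t})"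
    unfolding cylinder_def by simp
  also have "cylinder M Y (Pair (b + 1) ` {c..s - b - 1}) ?B = cylinder M (\<lambda>k. Y (b + 1, k)) J A"
    unfolding cylinder_row cylinder_def using assms(2) by (auto simp: new split: if_splits)
  finally show ?thesis .
qed

locale space_time_field = bool_field M Y
  for M :: "'w measure" and Y :: "int \<times> int \<Rightarrow> 'w \<Rightarrow> bool"
begin

text \<open>The weight of a pattern on the larger trapezoid depends on the states of its top row through one
  factor for each cell of that row only, because the parents of these cells lie below. Summing the
  weights over all admissible top rows therefore factorizes. For \<open>b = a - 1\<close> the smaller trapezoid is
  empty and the statement is about the bottom row.\<close>

lemma prob_next_row:
  assumes law: "trapezoid_law M \<theta> p Y a (b + 1) c s" and "a \<le> b + 1"
  shows "prob (cylinder M Y (cells a (b + 1) c s) (\<lambda>t. if t \<in> cells a b c s then {x t} else A t)) =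
         (\<Prod>t\<in>cells a b c s. pmf (cell_kernel \<theta> p a x t) (x t)) *
         (\<Prod>k\<in>{c..s - b - 1}. measure (measure_pmf (cell_kernel \<theta> p a x (b + 1, k))) (A (b + 1, k)))"
proof -
  let ?D = "cells a (b + 1) c s"
  let ?B = "\<lambda>t. if t \<in> cells a b c s then {x t} else A t"
  let ?K = "cell_kernel \<theta> p a x"
  have K: "cell_kernel \<theta> p a y t = ?K t" if "y \<in> PiE ?D ?B" "t \<in> ?D" for y t
  proof (rule cell_kernel_cong[OF that(2)])
    fix u assume u: "u \<in> cells a b c s"
    then have "u \<in> ?D" by (auto simp: cells_def)
    then show "y u = x u" using PiE_mem[OF that(1), of u] u by auto
  qed
  have "prob (cylinder M Y ?D ?B) = (\<Sum>y\<in>PiE ?D ?B. \<Prod>t\<in>?D. pmf (cell_kernel \<theta> p a y t) (y t))"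
    by (subst prob_cylinder_eq_sum_atoms[OF finite_cells])
       (use law in \<open>simp only: trapezoid_law_def\<close>)
  also have "\<dots> = (\<Sum>y\<in>PiE ?D ?B. \<Prod>t\<in>?D. pmf (?K t) (y t))"
    by (intro sum.cong prod.cong refl) (simp add: K)
  also have "\<dots> = (\<Prod>t\<in>?D. \<Sum>v\<in>?B t. pmf (?K t) v)"
    by (rule prod_sum_PiE[symmetric]) auto
  also have "\<dots> = (\<Prod>t\<in>?D. measure (measure_pmf (?K t)) (?B t))"
    by (intro prod.cong refl measure_measure_pmf_finite[symmetric]) auto
  also have "\<dots> = (\<Prod>t\<in>cells a b c s. measure (measure_pmf (?K t)) (?B t)) *
                  (\<Prod>t\<in>Pair (b + 1) ` {c..s - b - 1}. measure (measure_pmf (?K t)) (?B t))"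
    unfolding cells_next_row(1)[OF assms(2)]
    by (rule prod.union_disjoint) (use cells_next_row(2)[OF assms(2), of c s] in auto)
  also have "(\<Prod>t\<in>cells a b c s. measure (measure_pmf (?K t)) (?B t)) = (\<Prod>t\<in>cells a b c s. pmf (?K t) (x t))"
    by (intro prod.cong refl) (simp add: measure_pmf_single)
  also have "(\<Prod>t\<in>Pair (b + 1) ` {c..s - b - 1}. measure (measure_pmf (?K t)) (?B t)) =
             (\<Prod>k\<in>{c..s - b - 1}. measure (measure_pmf (?K (b + 1, k))) (A (b + 1, k)))"
    by (subst prod.reindex) (auto simp: inj_on_def cells_def intro!: prod.cong)
  finally show ?thesis .
qed

lemma trapezoid_law_remove_row:
  assumes "trapezoid_law M \<theta> p Y a (b + 1) c s" "a \<le> b + 1"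
  shows "trapezoid_law M \<theta> p Y a b c s"
  unfolding trapezoid_law_def
proof
  fix x
  have "cells a b c s \<subseteq> cells a (b + 1) c s" by (auto simp: cells_def)
  from cylinder_extend[OF this, of "\<lambda>t. {x t}"]
  show "prob (cylinder M Y (cells a b c s) (\<lambda>t. {x t})) =
        (\<Prod>t\<in>cells a b c s. pmf (cell_kernel \<theta> p a x t) (x t))"
    using prob_next_row[OF assms, of x "\<lambda>_. UNIV"] by (simp add: measure_pmf.prob_space[simplified])
qed

text \<open>Downward induction from the height of the apex, forgetting the top row at each step.\<close>

lemma trapezoid_law_of_triangle_law:
  assumes "triangle_law M \<theta> p Y" "a \<le> b"
  shows "trapezoid_law M \<theta> p Y a b c s"
proof (cases "s - c \<le> b")
  case True
  then show ?thesis
    using assms(1) cells_above_apex[OF True] by (simp add: trapezoid_law_def triangle_law_def)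
next
  case False
  then have "b \<le> s - c" by simp
  then show ?thesis using \<open>a \<le> b\<close>
  proof (induction rule: int_le_induct)
    case base
    then show ?case using assms(1) by (simp add: triangle_law_def)
  next
    case (step b)
    then show ?case using trapezoid_law_remove_row[of \<theta> p a "b - 1" c s] by simp
  qed
qed

lemma distr_row_of_triangle_law:
  assumes "triangle_law M \<theta> p Y"
  shows "distr M (Pi\<^sub>M UNIV (\<lambda>_. count_space UNIV)) (\<lambda>\<omega> k. Y (n, k) \<omega>) = bernoulli_product p"
proof -
  interpret R: bool_field M "\<lambda>k. Y (n, k)" by (rule bool_field_reindex)
  have "prob (cylinder M (\<lambda>k. Y (n, k)) J A) = (\<Prod>j\<in>J. measure (measure_pmf (bernoulli_pmf p)) (A j))"
    if J: "finite J" for J A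
  proof -
    obtain a c s where "a \<le> n - 1" and J': "J \<subseteq> {c..s - (n - 1) - 1}"
      by (rule finite_subset_cells[OF finite.emptyI empty_subsetI J])
    let ?A = "\<lambda>t. if snd t \<in> J then A (snd t) else UNIV"
    have "cylinder M (\<lambda>k. Y (n, k)) J A = cylinder M Y (cells n n c s) ?A"
      using J' by (force simp: cells_single_row cylinder_row cylinder_def)
    moreover have "trapezoid_law M \<theta> p Y n ((n - 1) + 1) c s"
      using trapezoid_law_of_triangle_law[OF assms, of n n] by simp
    moreover have "cells n (n - 1) c s = {}" by (auto simp: cells_def)
    ultimately have "prob (cylinder M (\<lambda>k. Y (n, k)) J A) =
        (\<Prod>k\<in>{c..s - n}. measure (measure_pmf (bernoulli_pmf p)) (if k \<in> J then A k else UNIV))"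
      using prob_next_row[of \<theta> p n "n - 1" c s _ ?A] by (simp cong: if_cong)
    also have "\<dots> = (\<Prod>k\<in>J. measure (measure_pmf (bernoulli_pmf p)) (A k))"
      using J' by (intro prod.mono_neutral_cong_right) (auto simp: measure_pmf.prob_space[simplified])
    finally show ?thesis .
  qed
  then show ?thesis
    unfolding bernoulli_product_def by (subst R.distr_eq_PiM_iff) auto
qed

text \<open>The candidate for the conditional probability that row \<open>n + 1\<close> is in \<open>A\<close> on \<open>J\<close>.\<close>

definition next_row_prob ::
  "(bool \<Rightarrow> bool \<Rightarrow> real) \<Rightarrow> int \<Rightarrow> int set \<Rightarrow> (int \<Rightarrow> bool set) \<Rightarrow> 'w \<Rightarrow> real" where
  "next_row_prob \<theta> n J A \<omega> =
     (\<Prod>j\<in>J. measure (measure_pmf (bernoulli_pmf (\<theta> (Y (n, j) \<omega>) (Y (n, j + 1) \<omega>)))) (A j))"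

lemma measurable_next_row_prob:
  assumes "{n} \<times> UNIV \<subseteq> I"
  shows "next_row_prob \<theta> n J A \<in> borel_measurable (generated_sigma M Y I)"
  unfolding next_row_prob_def
  by (intro borel_measurable_prod borel_measurable_bool_pair[where g = "\<lambda>u v. measure (measure_pmf (bernoulli_pmf (\<theta> u v))) (A _)"]
        measurable_generated_sigma)
     (use assms in auto)

lemma next_row_prob_bounds: "0 \<le> next_row_prob \<theta> n J A \<omega>" "next_row_prob \<theta> n J A \<omega> \<le> 1"
  unfolding next_row_prob_def by (auto intro!: prod_nonneg prod_le_1)

lemma integrable_next_row_prob: "integrable M (next_row_prob \<theta> n J A)"
proof (rule integrable_const_bound[of _ 1])
  show "next_row_prob \<theta> n J A \<in> borel_measurable M"
    using measurable_from_subalg[OF subalgebra_generated_sigma measurable_next_row_prob, of n UNIV] by simp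
qed (simp add: next_row_prob_bounds)

text \<open>On an atom of the trapezoid the parents of the cells in \<open>J\<close> have known states, so the integrand is
  constant.\<close>

lemma set_integral_next_row_prob_atom:
  assumes "a \<le> n" "J \<subseteq> {c..s - n - 1}"
  shows "(\<integral>\<omega>\<in>cylinder M Y (cells a n c s) (\<lambda>t. {x t}). next_row_prob \<theta> n J A \<omega> \<partial>M) =
         prob (cylinder M Y (cells a n c s) (\<lambda>t. {x t})) *
         (\<Prod>j\<in>J. measure (measure_pmf (bernoulli_pmf (\<theta> (x (n, j)) (x (n, j + 1))))) (A j))"
    (is "(\<integral>\<omega>\<in>?C. _ \<partial>M) = _ * ?c")
proof -
  have "(\<integral>\<omega>\<in>?C. next_row_prob \<theta> n J A \<omega> \<partial>M) = (\<integral>\<omega>\<in>?C. ?c \<partial>M)"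
  proof (rule set_lebesgue_integral_cong)
    show "\<forall>\<omega>. \<omega> \<in> ?C \<longrightarrow> next_row_prob \<theta> n J A \<omega> = ?c"
    proof (intro allI impI)
      fix \<omega> assume "\<omega> \<in> ?C"
      then have x: "Y t \<omega> = x t" if "t \<in> cells a n c s" for t using that by (auto simp: cylinder_def)
      have "Y (n, j) \<omega> = x (n, j) \<and> Y (n, j + 1) \<omega> = x (n, j + 1)" if "j \<in> J" for j
        using that assms by (auto intro!: x simp: cells_def)
      then show "next_row_prob \<theta> n J A \<omega> = ?c"
        unfolding next_row_prob_def by (intro prod.cong) auto
    qed
  qed simp
  also have "\<dots> = prob ?C * ?c" by (simp add: set_integral_const emeasure_eq_measure)
  finally show ?thesis .
qed

text \<open>It suffices to compare integrals over atoms of trapezoids with top row \<open>n\<close>, and there both sides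
  are given by the trapezoid law one row higher. Admitting every \<open>I\<close> between row \<open>n\<close> and the whole
  past covers the Markov property and the conditioning on row \<open>n\<close> alone.\<close>

lemma cond_exp_next_row:
  assumes tri: "triangle_law M \<theta> p Y"
    and I: "{n} \<times> UNIV \<subseteq> I" "I \<subseteq> {..n} \<times> UNIV" and J: "finite J"
  shows "AE \<omega> in M. real_cond_exp M (generated_sigma M Y I)
           (indicator (cylinder M (\<lambda>k. Y (n + 1, k)) J A)) \<omega> = next_row_prob \<theta> n J A \<omega>"
proof (rule cond_exp_generated_eqI)
  interpret R: bool_field M "\<lambda>k. Y (n + 1, k)" by (rule bool_field_reindex)
  let ?E = "cylinder M (\<lambda>k. Y (n + 1, k)) J A"
  show intE: "integrable M (indicator ?E :: _ \<Rightarrow> real)"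
    using R.cylinder_sets[OF J] by (simp add: integrable_real_indicator emeasure_eq_measure)
  show "integrable M (next_row_prob \<theta> n J A)" by (rule integrable_next_row_prob)
  show "next_row_prob \<theta> n J A \<in> borel_measurable (generated_sigma M Y I)"
    by (rule measurable_next_row_prob[OF I(1)])
  fix F B assume F: "finite F" "F \<subseteq> I"
  obtain a c s where D: "a \<le> n" "F \<subseteq> cells a n c s" "J \<subseteq> {c..s - n - 1}"
    by (rule finite_subset_cells[OF F(1) order.trans[OF F(2) I(2)] J])
  let ?D = "cells a n c s"
  have atom: "(\<integral>\<omega>\<in>cylinder M Y ?D (\<lambda>t. {x t}). indicator ?E \<omega> \<partial>M) =
              (\<integral>\<omega>\<in>cylinder M Y ?D (\<lambda>t. {x t}). next_row_prob \<theta> n J A \<omega> \<partial>M)" for x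
  proof -
    let ?C = "cylinder M Y ?D (\<lambda>t. {x t})"
    \<comment> \<open>the constraint on row \<open>n + 1\<close>, extended to the whole interval above the trapezoid\<close>
    let ?A = "\<lambda>t. if snd t \<in> J then A (snd t) else UNIV"
    let ?c = "\<Prod>j\<in>J. measure (measure_pmf (bernoulli_pmf (\<theta> (x (n, j)) (x (n, j + 1))))) (A j)"
    have "?C \<inter> ?E = cylinder M Y (cells a (n + 1) c s) (\<lambda>t. if t \<in> ?D then {x t} else ?A t)"
      using D(1,3) by (intro cylinder_next_row[symmetric]) auto
    then have "prob (?C \<inter> ?E) = (\<Prod>t\<in>?D. pmf (cell_kernel \<theta> p a x t) (x t)) *
        (\<Prod>k\<in>{c..s - n - 1}. measure (measure_pmf (cell_kernel \<theta> p a x (n + 1, k))) (if k \<in> J then A k else UNIV))"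
      using prob_next_row[OF trapezoid_law_of_triangle_law[OF tri, of a "n + 1" c s], of x ?A] D(1) by (simp cong: if_cong)
    also have "(\<Prod>t\<in>?D. pmf (cell_kernel \<theta> p a x t) (x t)) = prob ?C"
      using trapezoid_law_of_triangle_law[OF tri D(1)] by (simp add: trapezoid_law_def)
    also have "(\<Prod>k\<in>{c..s - n - 1}. measure (measure_pmf (cell_kernel \<theta> p a x (n + 1, k))) (if k \<in> J then A k else UNIV)) = ?c"
      using D(1,3) by (intro prod.mono_neutral_cong_right) (auto simp: measure_pmf.prob_space[simplified])
    finally have 1: "prob (?C \<inter> ?E) = prob ?C * ?c" .
    show ?thesis
      by (simp only: set_integral_indicator_cylinder 1 set_integral_next_row_prob_atom[OF D(1,3)])
  qed
  show "(\<integral>\<omega>\<in>cylinder M Y F B. indicator ?E \<omega> \<partial>M) = (\<integral>\<omega>\<in>cylinder M Y F B. next_row_prob \<theta> n J A \<omega> \<partial>M)"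
    unfolding cylinder_extend[OF D(2)]
    by (subst set_integral_cylinder_eq_sum_atoms[OF finite_cells intE],
        subst set_integral_cylinder_eq_sum_atoms[OF finite_cells integrable_next_row_prob])
       (simp only: atom)
qed

end

section \<open>Triangle laws characterize stationary diagrams\<close>

lemma space_time_field_of_stationary_diagram:
  assumes "stationary_diagram M \<theta> p X"
  shows "space_time_field M (\<lambda>(n, k). X n k)"
  using assms unfolding stationary_diagram_def
  by (auto intro!: space_time_field.intro bool_field.intro bool_field_axioms.intro)

lemma field_law_eq: "field_law M X = distr M (Pi\<^sub>M UNIV (\<lambda>_. count_space UNIV)) (\<lambda>\<omega> t. (\<lambda>(n, k). X n k) t \<omega>)"
  unfolding field_law_def by (rule arg_cong[where f = "distr M _"]) (auto simp: fun_eq_iff)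

lemma cell_kernel_base: "t \<in> cells a a c s \<Longrightarrow> cell_kernel \<theta> p a x t = bernoulli_pmf p"
  by (cases t) (auto simp: cells_def)

context space_time_field
begin

text \<open>The converse of \<open>triangle_law_of_stationary_diagram\<close> below; together they allow a stationary diagram
  to be replaced by its triangle laws, which are easy to rotate.\<close>

lemma stationary_diagram_of_triangle_law:
  assumes \<theta>: "\<And>x y. \<theta> x y \<in> {0..1}" and tri: "triangle_law M \<theta> p Y"
  shows "stationary_diagram M \<theta> p (\<lambda>n k. Y (n, k))"
proof -
  have Y: "(\<lambda>(m, k). Y (m, k)) = Y" by auto
  have row: "AE \<omega> in M. prob_given M (generated_sigma M Y ({..n} \<times> UNIV)) (\<lambda>\<omega>'. \<forall>j\<in>J. Y (n + 1, j) \<omega>' \<in> A j) \<omega>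
      = next_row_prob \<theta> n J A \<omega>" if "finite J" for n J A
    using cond_exp_next_row[OF tri _ _ that, of n "{..n} \<times> UNIV"]
    unfolding prob_given_def cylinder_def by auto
  have cell: "AE \<omega> in M. prob_given M (generated_sigma M Y ({..n} \<times> UNIV)) (\<lambda>\<omega>'. Y (n + 1, j) \<omega>' \<in> A) \<omega>
      = next_row_prob \<theta> n {j} (\<lambda>_. A) \<omega>" for n j A
    using row[of "{j}" n "\<lambda>_. A"] by simp
  have indep: "cond_indep_given M (generated_sigma M Y ({..n} \<times> UNIV)) (\<lambda>k. Y (n + 1, k))" for n
    by (rule cond_indep_given_if_product, rule row[unfolded next_row_prob_def])
  have param: "AE \<omega> in M. prob_given M (generated_sigma M Y ({..n} \<times> UNIV)) (Y (n + 1, k)) \<omega>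
      = \<theta> (Y (n, k) \<omega>) (Y (n, k + 1) \<omega>)" for n k
    using cell[of n k "{True}"] \<theta> by (simp add: next_row_prob_def measure_pmf_single)
  show ?thesis
    unfolding stationary_diagram_def Y Let_def
    using prob_space_axioms measurable_Y distr_row_of_triangle_law[OF tri] indep param by blast
qed

text \<open>The definition of a stationary diagram prescribes the conditional probability of the state 1 for
  single cells; this extends to all sets of states by complementation, and to several cells by
  conditional independence.\<close>

lemma cond_exp_next_row_of_stationary:
  assumes \<theta>: "\<And>x y. \<theta> x y \<in> {0..1}" and stat: "stationary_diagram M \<theta> p (\<lambda>n k. Y (n, k))"
    and J: "finite J"
  shows "AE \<omega> in M. real_cond_exp M (generated_sigma M Y ({..n} \<times> UNIV))
           (indicator (cylinder M (\<lambda>k. Y (n + 1, k)) J A)) \<omega> = next_row_prob \<theta> n J A \<omega>"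
proof -
  let ?G = "generated_sigma M Y ({..n} \<times> UNIV)"
  let ?E = "\<lambda>j A. {\<omega> \<in> space M. Y (n + 1, j) \<omega> \<in> A}"
  let ?q = "\<lambda>j A \<omega>. measure (measure_pmf (bernoulli_pmf (\<theta> (Y (n, j) \<omega>) (Y (n, j + 1) \<omega>)))) A"
  interpret G: sigma_finite_subalgebra M ?G
    by (intro sigma_finite_subalgebraI subalgebra_generated_sigma)
  have Y: "(\<lambda>(m, k). Y (m, k)) = Y" by auto
  have indep: "AE \<omega> in M. real_cond_exp M ?G (indicator (cylinder M (\<lambda>k. Y (n + 1, k)) J A)) \<omega> =
      (\<Prod>j\<in>J. real_cond_exp M ?G (indicator (?E j (A j))) \<omega>)"
    using stat J unfolding stationary_diagram_def Let_def cond_indep_given_def Y prob_given_def cylinder_def by simp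
  have true: "AE \<omega> in M. real_cond_exp M ?G (indicator (?E j {True})) \<omega> = \<theta> (Y (n, j) \<omega>) (Y (n, j + 1) \<omega>)" for j
    using stat unfolding stationary_diagram_def Let_def Y prob_given_def by simp
  have int: "integrable M (indicator (?E j B) :: _ \<Rightarrow> real)" for j B
    by (rule integrable_real_indicator) (auto simp: emeasure_eq_measure)
  have const: "AE \<omega> in M. real_cond_exp M ?G (\<lambda>_. c) \<omega> = c" for c :: real
    by (rule G.real_cond_exp_F_meas) auto
  have cell: "AE \<omega> in M. real_cond_exp M ?G (indicator (?E j B)) \<omega> = ?q j B \<omega>" for j B
  proof -
    have "B \<in> Pow UNIV" by simp
    then consider "B = {}" | "B = {True}" | "B = {False}" | "B = UNIV"
      by (auto simp: UNIV_bool)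
    then show ?thesis
    proof cases
      case 1
      then show ?thesis using const[of 0] by (simp add: indicator_def[abs_def])
    next
      case 2
      then show ?thesis using true[of j] \<theta> by (simp add: measure_pmf_single)
    next
      case 3
      have "AE \<omega> in M. real_cond_exp M ?G (indicator (?E j B)) \<omega> =
              real_cond_exp M ?G (\<lambda>\<omega>. 1 - indicator (?E j {True}) \<omega>) \<omega>"
        by (rule G.real_cond_exp_cong) (auto simp: 3 indicator_def)
      moreover have "AE \<omega> in M. real_cond_exp M ?G (\<lambda>\<omega>. 1 - indicator (?E j {True}) \<omega>) \<omega> =
              real_cond_exp M ?G (\<lambda>_. 1) \<omega> - real_cond_exp M ?G (indicator (?E j {True})) \<omega>"
        using int[of j "{True}"] by (intro G.real_cond_exp_diff) simp_all
      ultimately show ?thesis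
        using true[of j] const[of 1]
        by eventually_elim (use \<theta> in \<open>simp add: 3 measure_pmf_single\<close>)
    next
      case 4
      have "AE \<omega> in M. real_cond_exp M ?G (indicator (?E j B)) \<omega> = real_cond_exp M ?G (\<lambda>_. 1) \<omega>"
        by (rule G.real_cond_exp_cong) (auto simp: 4)
      with const[of 1] show ?thesis
        by eventually_elim (simp add: 4 measure_pmf.prob_space[simplified])
    qed
  qed
  have "AE \<omega> in M. \<forall>j\<in>J. real_cond_exp M ?G (indicator (?E j (A j))) \<omega> = ?q j (A j) \<omega>"
    using J cell by (intro AE_finite_allI) auto
  with indep show ?thesis by eventually_elim (simp add: next_row_prob_def)
qed

lemma prob_next_row_of_stationary:
  assumes \<theta>: "\<And>x y. \<theta> x y \<in> {0..1}" and stat: "stationary_diagram M \<theta> p (\<lambda>n k. Y (n, k))"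
    and J: "finite J" and F: "finite F" "F \<subseteq> {..n} \<times> UNIV"
  shows "prob (cylinder M Y F B \<inter> cylinder M (\<lambda>k. Y (n + 1, k)) J A) =
         (\<integral>\<omega>\<in>cylinder M Y F B. next_row_prob \<theta> n J A \<omega> \<partial>M)"
proof -
  let ?G = "generated_sigma M Y ({..n} \<times> UNIV)"
  let ?C = "cylinder M Y F B" and ?E = "cylinder M (\<lambda>k. Y (n + 1, k)) J A"
  interpret R: bool_field M "\<lambda>k. Y (n + 1, k)" by (rule bool_field_reindex)
  interpret G: sigma_finite_subalgebra M ?G
    by (intro sigma_finite_subalgebraI subalgebra_generated_sigma)
  have intE: "integrable M (indicator ?E :: _ \<Rightarrow> real)"
    using R.cylinder_sets[OF J] by (simp add: integrable_real_indicator emeasure_eq_measure)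
  have [measurable]: "?C \<in> sets M" "next_row_prob \<theta> n J A \<in> borel_measurable M"
    using F(1) borel_measurable_integrable[OF integrable_next_row_prob] by simp_all
  have "prob (?C \<inter> ?E) = (\<integral>\<omega>\<in>?C. indicator ?E \<omega> \<partial>M)"
    by (rule set_integral_indicator_cylinder[symmetric])
  also have "\<dots> = (\<integral>\<omega>\<in>?C. real_cond_exp M ?G (indicator ?E) \<omega> \<partial>M)"
    by (rule G.real_cond_exp_intA[OF intE cylinder_in_generated_sigma[OF F]])
  also have "\<dots> = (\<integral>\<omega>\<in>?C. next_row_prob \<theta> n J A \<omega> \<partial>M)"
    unfolding set_lebesgue_integral_def
  proof (rule integral_cong_AE)
    show "AE \<omega> in M. indicat_real ?C \<omega> *\<^sub>R real_cond_exp M ?G (indicat_real ?E) \<omega> =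
                     indicat_real ?C \<omega> *\<^sub>R next_row_prob \<theta> n J A \<omega>"
      using cond_exp_next_row_of_stationary[OF \<theta> stat J, of n A] by eventually_elim simp
  qed measurable
  finally show ?thesis .
qed

text \<open>Induction on the height of the trapezoid: the bottom row is Bernoulli, and conditioning on the past
  multiplies the weight of a pattern by the transition probabilities into the new row.\<close>

lemma triangle_law_of_stationary_diagram:
  assumes \<theta>: "\<And>x y. \<theta> x y \<in> {0..1}" and stat: "stationary_diagram M \<theta> p (\<lambda>n k. Y (n, k))"
  shows "triangle_law M \<theta> p Y"
proof -
  have "trapezoid_law M \<theta> p Y a b c s" if "a \<le> b" for a b c s
    using that
  proof (induction rule: int_ge_induct)
    case base
    interpret R: bool_field M "\<lambda>k. Y (a, k)" by (rule bool_field_reindex)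
    have "distr M (Pi\<^sub>M UNIV (\<lambda>_. count_space UNIV)) (\<lambda>\<omega> k. Y (a, k) \<omega>) = Pi\<^sub>M UNIV (\<lambda>_. measure_pmf (bernoulli_pmf p))"
      using stat unfolding stationary_diagram_def bernoulli_product_def by simp
    then have row: "prob (cylinder M (\<lambda>k. Y (a, k)) J A) = (\<Prod>j\<in>J. measure (measure_pmf (bernoulli_pmf p)) (A j))"
      if "finite J" for J A
      using that by (subst (asm) R.distr_eq_PiM_iff) blast
    show ?case
      unfolding trapezoid_law_def
    proof
      fix x
      have "(\<Prod>t\<in>cells a a c s. pmf (cell_kernel \<theta> p a x t) (x t)) =
            (\<Prod>t\<in>Pair a ` {c..s - a}. pmf (bernoulli_pmf p) (x t))"
        by (rule prod.cong) (auto simp: cells_single_row cell_kernel_base)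
      also have "\<dots> = (\<Prod>k\<in>{c..s - a}. pmf (bernoulli_pmf p) (x (a, k)))"
        by (subst prod.reindex) (auto simp: inj_on_def)
      also have "\<dots> = prob (cylinder M Y (cells a a c s) (\<lambda>t. {x t}))"
        by (simp add: cells_single_row cylinder_row row measure_pmf_single)
      finally show "prob (cylinder M Y (cells a a c s) (\<lambda>t. {x t})) =
            (\<Prod>t\<in>cells a a c s. pmf (cell_kernel \<theta> p a x t) (x t))" ..
    qed
  next
    case (step b)
    have ab: "a \<le> b + 1" using step by simp
    let ?D = "cells a b c s" and ?J = "{c..s - b - 1}"
    show ?case
      unfolding trapezoid_law_def
    proof
      fix x
      let ?C = "cylinder M Y ?D (\<lambda>t. {x t})"
      let ?c = "\<Prod>k\<in>?J. pmf (cell_kernel \<theta> p a x (b + 1, k)) (x (b + 1, k))"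
      have D: "?D \<subseteq> {..b} \<times> UNIV" by (auto simp: cells_def)
      have split: "(\<lambda>t. if t \<in> ?D then {x t} else if snd t \<in> ?J then {x (b + 1, snd t)} else UNIV) t = {x t}"
        if "t \<in> cells a (b + 1) c s" for t
        using that unfolding cells_next_row(1)[OF ab] by auto
      have "cylinder M Y (cells a (b + 1) c s) (\<lambda>t. {x t}) =
            cylinder M Y (cells a (b + 1) c s)
              (\<lambda>t. if t \<in> ?D then {x t} else if snd t \<in> ?J then {x (b + 1, snd t)} else UNIV)"
        unfolding cylinder_def using split by simp
      also have "\<dots> = ?C \<inter> cylinder M (\<lambda>k. Y (b + 1, k)) ?J (\<lambda>k. {x (b + 1, k)})"
        by (rule cylinder_next_row[OF ab order.refl])
      finally have "prob (cylinder M Y (cells a (b + 1) c s) (\<lambda>t. {x t})) =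
          (\<integral>\<omega>\<in>?C. next_row_prob \<theta> b ?J (\<lambda>k. {x (b + 1, k)}) \<omega> \<partial>M)"
        by (simp add: prob_next_row_of_stationary[OF \<theta> stat _ finite_cells D])
      also have "\<dots> = prob ?C *
          (\<Prod>k\<in>?J. measure (measure_pmf (bernoulli_pmf (\<theta> (x (b, k)) (x (b, k + 1))))) {x (b + 1, k)})"
        by (rule set_integral_next_row_prob_atom[OF step(1) order.refl])
      also have "(\<Prod>k\<in>?J. measure (measure_pmf (bernoulli_pmf (\<theta> (x (b, k)) (x (b, k + 1))))) {x (b + 1, k)}) = ?c"
        using step(1) by (intro prod.cong) (auto simp: measure_pmf_single)
      also have "prob ?C = (\<Prod>t\<in>?D. pmf (cell_kernel \<theta> p a x t) (x t))"
        using step by (simp add: trapezoid_law_def)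
      also have "\<dots> * ?c = (\<Prod>t\<in>cells a (b + 1) c s. pmf (cell_kernel \<theta> p a x t) (x t))"
        unfolding cells_next_row(1)[OF ab]
        by (subst prod.union_disjoint)
           (use cells_next_row(2)[OF ab, of c s] in \<open>auto simp: prod.reindex inj_on_def\<close>)
      finally show "prob (cylinder M Y (cells a (b + 1) c s) (\<lambda>t. {x t})) =
          (\<Prod>t\<in>cells a (b + 1) c s. pmf (cell_kernel \<theta> p a x t) (x t))" .
    qed
  qed
  \<comment> \<open>a triangle whose apex would lie below its bottom row is empty\<close>
  moreover have "trapezoid_law M \<theta> p Y a (s - c) c s" if "s - c < a" for a c s
  proof -
    have "cells a (s - c) c s = {}" using that by (auto simp: cells_def)
    then show ?thesis by (simp add: trapezoid_law_def cylinder_def prob_space)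
  qed
  ultimately show ?thesis unfolding triangle_law_def by (metis not_le)
qed

text \<open>Every finite set of cells lies in a trapezoid, so the triangle laws fix all finite-dimensional
  laws.\<close>

lemma field_law_unique:
  assumes "space_time_field N Z" "triangle_law M \<theta> p Y" "triangle_law N \<theta> p Z"
  shows "distr M (Pi\<^sub>M UNIV (\<lambda>_. count_space UNIV)) (\<lambda>\<omega> t. Y t \<omega>) =
         distr N (Pi\<^sub>M UNIV (\<lambda>_. count_space UNIV)) (\<lambda>\<omega> t. Z t \<omega>)"
proof -
  interpret N: space_time_field N Z by fact
  show ?thesis
  proof (rule distr_field_eqI[OF N.bool_field_axioms])
    fix F :: "(int \<times> int) set" and A assume F: "finite F"
    obtain n where n: "F \<subseteq> {..n} \<times> UNIV"
    proof -
      obtain n where "\<And>m. m \<in> fst ` F \<Longrightarrow> m \<le> n"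
        using F by (meson bdd_above_finite bdd_above_def finite_imageI)
      then have "F \<subseteq> {..n} \<times> UNIV" by force
      then show ?thesis by (rule that)
    qed
    obtain a c s where D: "a \<le> n" "F \<subseteq> cells a n c s"
      by (rule finite_subset_cells[OF F n finite.emptyI])
    have "prob (cylinder M Y (cells a n c s) (\<lambda>t. {x t})) = measure N (cylinder N Z (cells a n c s) (\<lambda>t. {x t}))" for x
      using trapezoid_law_of_triangle_law[OF assms(2) D(1)] N.trapezoid_law_of_triangle_law[OF assms(3) D(1)]
      by (simp add: trapezoid_law_def)
    then have "prob (cylinder M Y (cells a n c s) B) = measure N (cylinder N Z (cells a n c s) B)" for B
      by (subst prob_cylinder_eq_sum_atoms[OF finite_cells],
          subst N.prob_cylinder_eq_sum_atoms[OF finite_cells]) simp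
    then show "prob (cylinder M Y F A) = measure N (cylinder N Z F A)"
      unfolding cylinder_extend[OF D(2)] N.cylinder_extend[OF D(2)] .
  qed
qed

end

section \<open>Invariance of the Bernoulli product measure\<close>

text \<open>Makes the composition \<open>bernoulli_product p \<bind> pca_step \<theta>\<close> meaningful; measurability is
  checked on the cylinders that generate the product \<open>\<sigma>\<close>-algebra.\<close>

lemma pca_step_kernel:
  "pca_step \<theta> \<in> measurable (bernoulli_product p) (subprob_algebra (Pi\<^sub>M UNIV (\<lambda>_. count_space UNIV)))"
proof (rule measurable_subprob_algebra_generated[OF sets_PiM Int_stable_prod_algebra prod_algebra_sets_into_space])
  fix x :: "int \<Rightarrow> bool"
  interpret product_prob_space "\<lambda>k. measure_pmf (bernoulli_pmf (\<theta> (x k) (x (k + 1))))" UNIV ..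
  show "subprob_space (pca_step \<theta> x)"
    unfolding pca_step_def by (rule prob_space_imp_subprob_space) unfold_locales
  show "sets (pca_step \<theta> x) = sets (Pi\<^sub>M UNIV (\<lambda>_. count_space UNIV))"
    unfolding pca_step_def by (rule sets_PiM_pmf)
next
  fix A :: "(int \<Rightarrow> bool) set" assume "A \<in> prod_algebra UNIV (\<lambda>_. count_space UNIV)"
  then obtain J E where A: "A = prod_emb UNIV (\<lambda>_. count_space UNIV) J (Pi\<^sub>E J E)" and J: "finite J"
    by (rule prod_algebraE) auto
  have "(\<lambda>x. x k) \<in> measurable (bernoulli_product p) (count_space UNIV)" for k
    using bool_field.measurable_Y[OF bool_field_PiM] unfolding bernoulli_product_def .
  then have "(\<lambda>x. \<Prod>j\<in>J. measure (measure_pmf (bernoulli_pmf (\<theta> (x j) (x (j + 1))))) (E j))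
               \<in> borel_measurable (bernoulli_product p)"
    by (intro borel_measurable_prod borel_measurable_bool_pair[where g = "\<lambda>u v. measure (measure_pmf (bernoulli_pmf (\<theta> u v))) (E _)"])
  then show "(\<lambda>x. emeasure (pca_step \<theta> x) A) \<in> borel_measurable (bernoulli_product p)"
    unfolding pca_step_def A by (simp add: emeasure_PiM_pmf_emb[OF J])
next
  have "emeasure (pca_step \<theta> x) (\<Pi>\<^sub>E i\<in>UNIV. space (count_space UNIV)) = 1" for x
  proof -
    interpret product_prob_space "\<lambda>k. measure_pmf (bernoulli_pmf (\<theta> (x k) (x (k + 1))))" UNIV ..
    show ?thesis using emeasure_space_1 by (simp add: pca_step_def space_PiM)
  qed
  then show "(\<lambda>x. emeasure (pca_step \<theta> x) (\<Pi>\<^sub>E i\<in>UNIV. space (count_space UNIV))) \<in> borel_measurable (bernoulli_product p)"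
    by simp
qed

text \<open>Rows 0 and 1 of the diagram both have law \<open>\<mu>\<^sub>p\<close>, and row 1 arises from row 0 by one step of the
  automaton, so one step preserves \<open>\<mu>\<^sub>p\<close>.\<close>

lemma (in space_time_field) pca_invariant_of_stationary_diagram:
  assumes \<theta>: "\<And>x y. \<theta> x y \<in> {0..1}" and stat: "stationary_diagram M \<theta> p (\<lambda>n k. Y (n, k))"
  shows "pca_invariant \<theta> (bernoulli_product p)"
  unfolding pca_invariant_def
proof (rule sym, rule measure_eqI_PiM_infinite[where I = UNIV and M = "\<lambda>_. count_space UNIV"])
  let ?S = "Pi\<^sub>M UNIV (\<lambda>_::int. count_space (UNIV :: bool set))"
  interpret B: product_prob_space "\<lambda>_::int. measure_pmf (bernoulli_pmf p)" UNIV ..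
  have ne: "space (bernoulli_product p) \<noteq> {}"
    unfolding bernoulli_product_def by (rule B.not_empty)
  show setsB: "sets (bernoulli_product p) = sets ?S"
    unfolding bernoulli_product_def by (rule sets_PiM_pmf)
  show "sets (bernoulli_product p \<bind> pca_step \<theta>) = sets ?S"
    by (rule sets_bind[OF sets_kernel[OF pca_step_kernel] ne])
  show "finite_measure (bernoulli_product p)"
    unfolding bernoulli_product_def by unfold_locales
  fix A and J :: "int set" assume J: "finite J"
  let ?e = "prod_emb UNIV (\<lambda>_::int. count_space (UNIV :: bool set)) J (Pi\<^sub>E J A)"
  let ?q = "\<lambda>x. \<Prod>j\<in>J. measure (measure_pmf (bernoulli_pmf (\<theta> (x j) (x (j + 1))))) (A j)"
  have e: "?e \<in> sets ?S" using J by (intro sets_PiM_I) auto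
  have law: "distr M ?S (\<lambda>\<omega> k. Y (n, k) \<omega>) = bernoulli_product p" for n
    using stat unfolding stationary_diagram_def by simp
  interpret R0: bool_field M "\<lambda>k. Y (0, k)" by (rule bool_field_reindex)
  interpret R1: bool_field M "\<lambda>k. Y (0 + 1, k)" by (rule bool_field_reindex)
  have "emeasure (bernoulli_product p \<bind> pca_step \<theta>) ?e = (\<integral>\<^sup>+x. emeasure (pca_step \<theta> x) ?e \<partial>bernoulli_product p)"
    by (rule emeasure_bind[OF ne pca_step_kernel e])
  also have "\<dots> = (\<integral>\<^sup>+x. emeasure (pca_step \<theta> x) ?e \<partial>distr M ?S (\<lambda>\<omega> k. Y (0, k) \<omega>))"
    by (simp only: law)
  also have "\<dots> = (\<integral>\<^sup>+\<omega>. emeasure (pca_step \<theta> (\<lambda>k. Y (0, k) \<omega>)) ?e \<partial>M)"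
  proof (rule nn_integral_distr[OF R0.measurable_field])
    show "(\<lambda>x. emeasure (pca_step \<theta> x) ?e) \<in> borel_measurable (distr M ?S (\<lambda>\<omega> k. Y (0, k) \<omega>))"
      unfolding law by (rule measurable_emeasure_kernel[OF pca_step_kernel e])
  qed
  also have "\<dots> = (\<integral>\<^sup>+\<omega>. ennreal (next_row_prob \<theta> 0 J A \<omega>) \<partial>M)"
    by (simp add: pca_step_def emeasure_PiM_pmf_emb[OF J] next_row_prob_def)
  also have "\<dots> = ennreal (\<integral>\<omega>. next_row_prob \<theta> 0 J A \<omega> \<partial>M)"
    by (rule nn_integral_eq_integral[OF integrable_next_row_prob]) (simp add: next_row_prob_bounds)
  also have "(\<integral>\<omega>. next_row_prob \<theta> 0 J A \<omega> \<partial>M) = (\<integral>\<omega>\<in>space M. next_row_prob \<theta> 0 J A \<omega> \<partial>M)"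
    unfolding set_lebesgue_integral_def by (intro Bochner_Integration.integral_cong) auto
  also have "\<dots> = prob (cylinder M (\<lambda>k. Y (0 + 1, k)) J A)"
    using prob_next_row_of_stationary[OF \<theta> stat J, of "{}" 0 undefined A]
      R1.cylinder_subset_space[of J A] by (simp add: cylinder_def Int_absorb1)
  also have "ennreal \<dots> = emeasure (bernoulli_product p) ?e"
    using R1.emeasure_distr_cylinder[OF J, of A] unfolding law by simp
  finally show "emeasure (bernoulli_product p) ?e = emeasure (bernoulli_product p \<bind> pca_step \<theta>) ?e" ..
qed

section \<open>Rotating the triangle\<close>

text \<open>If the corners of a small triangle are \<open>x\<close>, \<open>y\<close> at the bottom and \<open>z\<close> at the top, this expresses that
  its weight can be read as a transition from \<open>x\<close>, \<open>y\<close> to \<open>z\<close> or, after rotation, from \<open>z\<close>, \<open>x\<close> to \<open>y\<close>.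
  When \<open>y = z\<close> it is immediate; the cases \<open>y \<noteq> z\<close> are the two balance equations, for instance
  \<open>p (1 - \<theta>\<^sub>1\<^sub>1) = (1 - p) \<theta>\<^sub>1\<^sub>0\<close>.\<close>

lemma rotated_parameter_pmf_swap:
  fixes \<theta> \<theta>' :: "bool \<Rightarrow> bool \<Rightarrow> real"
  assumes \<theta>: "\<And>x y. \<theta> x y \<in> {0..1}" and p: "p \<in> {0<..<1}"
    and bal: "(1 - p) * \<theta> False False + p * \<theta> False True = p"
      "(1 - p) * \<theta> True False + p * \<theta> True True = p"
    and \<theta>': "\<And>x y. \<theta>' x y = \<theta> y x"
  shows "pmf (bernoulli_pmf p) y * pmf (bernoulli_pmf (\<theta> x y)) z =
         pmf (bernoulli_pmf p) z * pmf (bernoulli_pmf (\<theta>' z x)) y"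
proof -
  have "0 \<le> \<theta> u v" "\<theta> u v \<le> 1" for u v using \<theta>[of u v] by auto
  then show ?thesis
    using p bal by (cases x; cases y; cases z) (simp_all add: \<theta>' algebra_simps)
qed

text \<open>The right-hand side is the weight of the same pattern when the triangle is grown from its left
  side \<open>k = c\<close>: a cell \<open>(n, k)\<close> with \<open>k > c\<close> is then updated from \<open>(n + 1, k - 1)\<close> and \<open>(n, k - 1)\<close>.
  Relative to the product of all Bernoulli weights, both sides have one factor for each small
  triangle. The left-hand side attaches it to the top corner, the right-hand side to the right
  corner.\<close>

lemma prod_triangle_rotate:
  fixes \<theta> \<theta>' :: "bool \<Rightarrow> bool \<Rightarrow> real"
  assumes p: "p \<in> {0<..<1}"
    and swap: "\<And>x y z. pmf (bernoulli_pmf p) y * pmf (bernoulli_pmf (\<theta> x y)) z =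
         pmf (bernoulli_pmf p) z * pmf (bernoulli_pmf (\<theta>' z x)) y"
  shows "(\<Prod>t\<in>cells a (s - c) c s. pmf (cell_kernel \<theta> p a x t) (x t)) =
         (\<Prod>(n, k)\<in>cells a (s - c) c s.
            pmf (bernoulli_pmf (if k = c then p else \<theta>' (x (n + 1, k - 1)) (x (n, k - 1)))) (x (n, k)))"
proof -
  let ?T = "cells a (s - c) c s"
  define b where "b t = pmf (bernoulli_pmf p) (x t)" for t
  have b: "b t \<noteq> 0" for t using p by (cases "x t") (auto simp: b_def)
  define r where "r = (\<lambda>(n, k). pmf (bernoulli_pmf (\<theta> (x (n - 1, k)) (x (n - 1, k + 1)))) (x (n, k)) / b (n, k))"
  define r' where "r' = (\<lambda>(n, k). pmf (bernoulli_pmf (\<theta>' (x (n + 1, k - 1)) (x (n, k - 1)))) (x (n, k)) / b (n, k))"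
  have "(\<Prod>t\<in>?T. pmf (cell_kernel \<theta> p a x t) (x t)) = (\<Prod>t\<in>?T. b t * (if fst t \<noteq> a then r t else 1))"
    using b by (intro prod.cong) (auto simp: r_def b_def)
  also have "\<dots> = (\<Prod>t\<in>?T. b t) * (\<Prod>t\<in>{t \<in> ?T. fst t \<noteq> a}. r t)"
    by (simp only: prod.distrib prod.inter_filter[OF finite_cells])
  also have "(\<Prod>t\<in>{t \<in> ?T. fst t \<noteq> a}. r t) = (\<Prod>t\<in>{t \<in> ?T. snd t \<noteq> c}. r' t)"
  \<comment> \<open>from the top corner of a small triangle to its right corner\<close>
  proof (rule prod.reindex_bij_witness[where i = "\<lambda>(n, k). (n + 1, k - 1)" and j = "\<lambda>(n, k). (n - 1, k + 1)"])
    fix t assume "t \<in> {t \<in> ?T. fst t \<noteq> a}"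
    obtain n k where t: "t = (n, k)" by (cases t)
    have "r' (n - 1, k + 1) = r (n, k)"
      using swap[of "x (n - 1, k + 1)" "x (n - 1, k)" "x (n, k)"] b[of "(n, k)"] b[of "(n - 1, k + 1)"]
      by (simp add: r_def r'_def b_def field_simps)
    then show "r' (case t of (n, k) \<Rightarrow> (n - 1, k + 1)) = r t" by (simp add: t)
  qed (auto simp: cells_def)
  also have "(\<Prod>t\<in>?T. b t) * \<dots> = (\<Prod>t\<in>?T. b t * (if snd t \<noteq> c then r' t else 1))"
    by (simp only: prod.distrib prod.inter_filter[OF finite_cells])
  also have "\<dots> = (\<Prod>(n, k)\<in>?T.
      pmf (bernoulli_pmf (if k = c then p else \<theta>' (x (n + 1, k - 1)) (x (n, k - 1)))) (x (n, k)))"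
    using b by (intro prod.cong) (auto simp: r'_def b_def)
  finally show ?thesis .
qed

text \<open>The rotation \<open>(m, j) \<mapsto> (- m - j, m)\<close> maps triangles to triangles and takes the bottom row of the
  one to the left side of the other.\<close>

lemma (in space_time_field) triangle_law_rotate:
  fixes \<theta> \<theta>' :: "bool \<Rightarrow> bool \<Rightarrow> real"
  assumes p: "p \<in> {0<..<1}"
    and swap: "\<And>x y z. pmf (bernoulli_pmf p) y * pmf (bernoulli_pmf (\<theta> x y)) z =
         pmf (bernoulli_pmf p) z * pmf (bernoulli_pmf (\<theta>' z x)) y"
    and tri: "triangle_law M \<theta> p Y"
  shows "triangle_law M \<theta>' p (\<lambda>(m, j). Y (- m - j, m))"
  unfolding triangle_law_def trapezoid_law_def
proof (intro allI)
  fix a c s and y :: "int \<times> int \<Rightarrow> bool"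
  let ?Z = "\<lambda>(m, j). Y (- m - j, m)"
  let ?S = "cells a (s - c) c s" and ?T = "cells (- s) (- c - a) a (- c)"
  define x where "x = (\<lambda>(n, k). y (k, - n - k))"
  have "cylinder M ?Z ?S (\<lambda>t. {y t}) = cylinder M Y ?T (\<lambda>t. {x t})"
  proof -
    have "(\<forall>t\<in>?S. ?Z t \<omega> = y t) \<longleftrightarrow> (\<forall>t\<in>?T. Y t \<omega> = x t)" for \<omega>
    proof (rule iffI; rule ballI)
      fix u assume Z: "\<forall>t\<in>?S. ?Z t \<omega> = y t" and "u \<in> ?T"
      then obtain n k where u: "u = (n, k)" and t: "(n, k) \<in> ?T" by (cases u) auto
      have "(k, - n - k) \<in> ?S" using t by (auto simp: cells_def)
      with Z have "?Z (k, - n - k) \<omega> = y (k, - n - k)" by blast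
      then show "Y u \<omega> = x u" by (simp add: x_def u)
    next
      fix u assume Y: "\<forall>t\<in>?T. Y t \<omega> = x t" and "u \<in> ?S"
      then obtain m j where u: "u = (m, j)" and t: "(m, j) \<in> ?S" by (cases u) auto
      have "(- m - j, m) \<in> ?T" using t by (auto simp: cells_def)
      with Y have "Y (- m - j, m) \<omega> = x (- m - j, m)" by blast
      then show "?Z u \<omega> = y u" by (simp add: x_def u)
    qed
    then show ?thesis by (simp add: cylinder_def)
  qed
  then have "prob (cylinder M ?Z ?S (\<lambda>t. {y t})) = (\<Prod>t\<in>?T. pmf (cell_kernel \<theta> p (- s) x t) (x t))"
    using tri unfolding triangle_law_def trapezoid_law_def by simp
  also have "\<dots> = (\<Prod>(n, k)\<in>?T.
      pmf (bernoulli_pmf (if k = a then p else \<theta>' (x (n + 1, k - 1)) (x (n, k - 1)))) (x (n, k)))"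
    by (rule prod_triangle_rotate[OF p swap])
  also have "\<dots> = (\<Prod>t\<in>?S. pmf (cell_kernel \<theta>' p a y t) (y t))"
    by (rule prod.reindex_bij_witness[where i = "\<lambda>(m, j). (- m - j, m)" and j = "\<lambda>(n, k). (k, - n - k)"])
       (auto simp: cells_def x_def algebra_simps)
  finally show "prob (cylinder M ?Z ?S (\<lambda>t. {y t})) = (\<Prod>t\<in>?S. pmf (cell_kernel \<theta>' p a y t) (y t))" .
qed

section \<open>The transversal diagram\<close>

theorem proposition3p4:
  fixes \<theta> \<theta>' :: "bool \<Rightarrow> bool \<Rightarrow> real" and p :: real
    and M :: "'w measure" and X Z :: "int \<Rightarrow> int \<Rightarrow> 'w \<Rightarrow> bool"
  assumes "\<And>x y. \<theta> x y \<in> {0..1}"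
    and "p \<in> {0<..<1}"
    and "(1 - p) * \<theta> False False + p * \<theta> False True = p"
    and "(1 - p) * \<theta> True False + p * \<theta> True True = p"
    and "stationary_diagram M \<theta> p X"
    and "\<theta>' False False = \<theta> False False" and "\<theta>' False True = \<theta> True False"
    and "\<theta>' True False = \<theta> False True" and "\<theta>' True True = \<theta> True True"
    and "\<And>m j. Z m j = X (- m - j) m"
  shows "pca_invariant \<theta> (bernoulli_product p) \<and>
    (\<forall>i. distr M (Pi\<^sub>M UNIV (\<lambda>_. count_space UNIV)) (\<lambda>\<omega> k. X k i \<omega>) = bernoulli_product p \<and>
         prob_space.indep_vars M (\<lambda>_. count_space UNIV) (\<lambda>k. X k i) UNIV \<and>
         (\<forall>k. distr M (count_space UNIV) (X k i) = measure_pmf (bernoulli_pmf p))) \<and>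
    stationary_diagram M \<theta>' p Z \<and>
    (\<forall>(N :: 'v measure) Y. stationary_diagram N \<theta>' p Y \<longrightarrow> field_law M Z = field_law N Y) \<and>
    (\<forall>i. let line = generated_sigma M (\<lambda>k. X k i) UNIV in
           cond_indep_given M line (\<lambda>k. X k (i + 1)) \<and>
           (\<forall>k. AE \<omega> in M. prob_given M line (X k (i + 1)) \<omega> = \<theta>' (X (k + 1) i \<omega>) (X k i \<omega>)))"
proof -
  note \<theta> = assms(1)
  have \<theta>'_eq: "\<theta>' x y = \<theta> y x" for x y using assms(6-9) by (cases x; cases y) simp_all
  have \<theta>': "\<theta>' x y \<in> {0..1}" for x y using \<theta> by (simp add: \<theta>'_eq)
  define Y where "Y = (\<lambda>(n, k). X n k)"
  define W where "W = (\<lambda>(m, j). Z m j)"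
  interpret Y: space_time_field M Y
    unfolding Y_def by (rule space_time_field_of_stationary_diagram[OF assms(5)])
  have W: "W = (\<lambda>(m, j). Y (- m - j, m))" by (auto simp: W_def Y_def assms(10))
  have statY: "stationary_diagram M \<theta> p (\<lambda>n k. Y (n, k))" using assms(5) by (simp add: Y_def)
  interpret W: space_time_field M W
    unfolding W space_time_field_def using Y.bool_field_reindex[of "\<lambda>(m, j). (- m - j, m)"]
    by (simp add: case_prod_unfold)
  have triY: "triangle_law M \<theta> p Y"
    by (rule Y.triangle_law_of_stationary_diagram[OF \<theta> statY])
  have triW: "triangle_law M \<theta>' p W"
    unfolding W
    by (rule Y.triangle_law_rotate[OF assms(2) rotated_parameter_pmf_swap[OF \<theta> assms(2-4) \<theta>'_eq] triY])
  have statZ: "stationary_diagram M \<theta>' p Z"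
    using W.stationary_diagram_of_triangle_law[OF \<theta>' triW] by (simp add: W_def)
  have XW: "X k i = W (i, - i - k)" for k i by (simp add: W_def assms(10))
  have line: "distr M (Pi\<^sub>M UNIV (\<lambda>_. count_space UNIV)) (\<lambda>\<omega> k. X k i \<omega>) = bernoulli_product p \<and>
         prob_space.indep_vars M (\<lambda>_. count_space UNIV) (\<lambda>k. X k i) UNIV \<and>
         (\<forall>k. distr M (count_space UNIV) (X k i) = measure_pmf (bernoulli_pmf p))" for i
  proof -
    interpret R: bool_field M "\<lambda>j. W (i, j)" by (rule W.bool_field_reindex)
    interpret L: bool_field M "\<lambda>k. X k i" unfolding XW by (rule W.bool_field_reindex)
    have "inj (\<lambda>k. - i - k)" by (auto simp: inj_on_def)
    then have law: "distr M (Pi\<^sub>M UNIV (\<lambda>_. count_space UNIV)) (\<lambda>\<omega> k. X k i \<omega>) =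
        Pi\<^sub>M UNIV (\<lambda>_. measure_pmf (bernoulli_pmf p))"
      unfolding XW using R.distr_iid_reindex W.distr_row_of_triangle_law[OF triW, of i]
      unfolding bernoulli_product_def by blast
    then show ?thesis
      using L.indep_vars_of_iid[OF law] L.marginal_of_iid[OF law] by (simp add: bernoulli_product_def)
  qed
  have unique: "field_law M Z = field_law N V" if "stationary_diagram N \<theta>' p V" for N :: "'v measure" and V
  proof -
    interpret V: space_time_field N "\<lambda>(n, k). V n k"
      by (rule space_time_field_of_stationary_diagram[OF that])
    have "triangle_law N \<theta>' p (\<lambda>(n, k). V n k)"
      using that by (intro V.triangle_law_of_stationary_diagram \<theta>') simp
    from W.field_law_unique[OF V.space_time_field_axioms triW this]
    show ?thesis unfolding field_law_eq W_def .
  qed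
  have cond: "AE \<omega> in M. prob_given M (generated_sigma M (\<lambda>k. X k i) UNIV) (\<lambda>\<omega>'. \<forall>k\<in>J. X k (i + 1) \<omega>' \<in> A k) \<omega> =
      (\<Prod>k\<in>J. measure (measure_pmf (bernoulli_pmf (\<theta>' (X (k + 1) i \<omega>) (X k i \<omega>)))) (A k))"
    if J: "finite J" for i J A
  proof -
    let ?f = "\<lambda>k. - (i + 1) - k"
    \<comment> \<open>a line of the diagram is a row of the rotated field, traversed backwards\<close>
    have "{X k i -` B \<inter> space M | k B. k \<in> UNIV} = {W t -` B \<inter> space M | t B. t \<in> {i} \<times> UNIV}"
    proof (intro set_eqI iffI)
      fix S assume "S \<in> {X k i -` B \<inter> space M | k B. k \<in> UNIV}"
      then obtain k B where "S = W (i, - i - k) -` B \<inter> space M" unfolding XW by auto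
      then show "S \<in> {W t -` B \<inter> space M | t B. t \<in> {i} \<times> UNIV}" by auto
    next
      fix S assume "S \<in> {W t -` B \<inter> space M | t B. t \<in> {i} \<times> UNIV}"
      then obtain j B where "S = W (i, j) -` B \<inter> space M" by auto
      then have "S = X (- i - j) i -` B \<inter> space M" by (simp add: XW)
      then show "S \<in> {X k i -` B \<inter> space M | k B. k \<in> UNIV}" by auto
    qed
    then have gen: "generated_sigma M (\<lambda>k. X k i) UNIV = generated_sigma M W ({i} \<times> UNIV)"
      unfolding generated_sigma_def by simp
    have inj: "inj_on ?f J" by (auto simp: inj_on_def)
    have "{\<omega> \<in> space M. \<forall>k\<in>J. X k (i + 1) \<omega> \<in> A k} = cylinder M (\<lambda>j. W (i + 1, j)) (?f ` J) (\<lambda>j. A (?f j))"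
      by (auto simp: cylinder_def XW)
    moreover have "AE \<omega> in M. real_cond_exp M (generated_sigma M W ({i} \<times> UNIV))
        (indicator (cylinder M (\<lambda>j. W (i + 1, j)) (?f ` J) (\<lambda>j. A (?f j)))) \<omega> =
        W.next_row_prob \<theta>' i (?f ` J) (\<lambda>j. A (?f j)) \<omega>"
      using J by (intro W.cond_exp_next_row[OF triW]) auto
    moreover have "W (i, ?f k) = X (k + 1) i" "W (i, ?f k + 1) = X k i" for k
      by (simp_all add: W_def assms(10) algebra_simps)
    then have "W.next_row_prob \<theta>' i (?f ` J) (\<lambda>j. A (?f j)) \<omega> =
        (\<Prod>k\<in>J. measure (measure_pmf (bernoulli_pmf (\<theta>' (X (k + 1) i \<omega>) (X k i \<omega>)))) (A k))" for \<omega>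
      unfolding W.next_row_prob_def prod.reindex[OF inj] o_def by simp
    ultimately show ?thesis unfolding prob_given_def gen by simp
  qed
  have cell: "AE \<omega> in M. prob_given M (generated_sigma M (\<lambda>k. X k i) UNIV) (\<lambda>\<omega>'. X k (i + 1) \<omega>' \<in> A) \<omega> =
      measure (measure_pmf (bernoulli_pmf (\<theta>' (X (k + 1) i \<omega>) (X k i \<omega>)))) A" for i k A
    using cond[of "{k}" i "\<lambda>_. A"] by simp
  have "cond_indep_given M (generated_sigma M (\<lambda>k. X k i) UNIV) (\<lambda>k. X k (i + 1))" for i
    by (rule cond_indep_given_if_product, rule cond)
  moreover have "AE \<omega> in M. prob_given M (generated_sigma M (\<lambda>k. X k i) UNIV) (X k (i + 1)) \<omega> =
      \<theta>' (X (k + 1) i \<omega>) (X k i \<omega>)" for i k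
    using cell[of i k "{True}"] \<theta>' by (simp add: measure_pmf_single)
  ultimately show ?thesis
    unfolding Let_def
    using Y.pca_invariant_of_stationary_diagram[OF \<theta> statY] line statZ unique by blast
qed

end
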